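(* Let $\alpha\in(0,1/2)$ be a fixed error tolerance. There is a constant $C>0$ depending only on $\alpha$ such that the following holds. Let $K\subset\mathbb{R}^d$ be a QCO set and let $\mathbf X$ be a dataset from the strong $\epsilon$-contamination model with $N$ original samples from $\mathcal N(\mu,\sigma^2\mathbf I_d)$, $\mu\in K$. For every integer $1\le k\le d$ set $$E_{\mathrm{raw}}^2(\epsilon,K,N,\sigma^2,k):=D_k^2(K)+\sigma^2\max\left\{\frac{\sqrt k}{N},\ \epsilon^2\ln\Big(\frac1\epsilon\Big),\ \sqrt{\frac{\epsilon^2\ln(1/\epsilon)\,k}{N}}\right\}.$$ If $\rho^2\ge C\,E_{\mathrm{raw}}^2(\epsilon,K,N,\sigma^2,k)$, then there exists a test $\phi_e$ for $H_0:\mu=0$ against $H_1:\mu\in K,\ \|\mu\|_2\ge\rho$ whose type-I and type-II errors are both uniformly less than $\alpha$ (uniformly over adversaries and over $\mu$ in the alternative). In other words, $$\rho_{\mathrm{critical}}\lesssim\min_{k}E_{\mathrm{raw}}(\epsilon,K,N,\sigma^2,k).$$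
   Context: QCO set: $K\subset\mathbb{R}^d$ is quadratically convex orthosymmetric if (1) $K$ is convex; (2) $K^2:=\{(\theta_1^2,\dots,\theta_d^2)^\top:\theta\in K\}$ is convex; (3) $\theta\in K$ implies $(\eta_1\theta_1,\dots,\eta_d\theta_d)^\top\in K$ for all $\eta_i\in\{-1,1\}$. Model: $\tilde{\mathbf X}=\{\tilde X_1,\dots,\tilde X_N\}$ are i.i.d. $\mathcal N(\mu,\sigma^2\mathbf I_d)$ with unknown $\mu\in K$ and known $\sigma>0$; $\mathbb{P}_\mu$ is the probability law when the mean is $\mu$. Strong $\epsilon$-contamination: $\epsilon\in[0,c_0)$ is known, with $c_0<1/2$ a fixed small absolute constant. An adversary $\mathcal C$ with full knowledge of the true distribution (and of $K$) inspects $\tilde{\mathbf X}$ and replaces up to $\epsilon N$ of the samples by arbitrary values; only $\mathbf X=\mathcal C(\tilde{\mathbf X})$ is observed, and the set of corrupted indices is unknown. A test is a $\{0,1\}$-valued measurable function $\phi$ of the observed data. Type-I error: $\sup_{\mathcal C}\mathbb{P}_0(\phi(\mathcal C(\tilde{\mathbf X}))=1)$. Type-II error: $\sup_{\mu\in K,\|\mu\|_2\ge\rho}\sup_{\mathcal C}\mathbb{P}_\mu(\phi(\mathcal C(\tilde{\mathbf X}))=0)$. $\rho_{\mathrm{critical}}$ is the infimum of all $\rho>0$ for which there is a test with both errors at most $\alpha$. Kolmogorov $k$-width: $D_k(K)=\inf_{P\in\mathcal P_k}\sup_{\theta\in K}\|\theta-P\theta\|_2$, $\mathcal P_k$ being the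 set of orthogonal projections of rank $k$ in $\mathbb{R}^d$. Expressions $\epsilon^2\ln(1/\epsilon)$ are read as $0$ at $\epsilon=0$. $\lesssim$ means up to a constant depending only on $\alpha$. Standing assumption of the paper: $\sup_{\theta\in K}\|\theta\|_2>\sigma/\sqrt N$. *)

theory Defs
  imports "HOL-Probability.Probability" "Jordan_Normal_Form.DL_Rank"
begin

text \<open>
  The constants of the theorem must not depend on the dimension, so the dimension \<open>d\<close> is a
  natural number and points of \<open>\<real>\<^sup>d\<close> are elements of \<open>carrier_vec d\<close>. The names \<open>vec\<close>, \<open>$\<close> and
  the infix dot clash with those of \<open>HOL-Analysis\<close>, hence the qualified or prefix forms below.
\<close>

definition vnorm :: "real Matrix.vec \<Rightarrow> real" where
  "vnorm v = sqrt (scalar_prod v v)"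

definition convex_vec :: "real Matrix.vec set \<Rightarrow> bool" where
  "convex_vec S \<longleftrightarrow>
     (\<forall>x\<in>S. \<forall>y\<in>S. \<forall>t\<in>{0..1::real}. t \<cdot>\<^sub>v x + (1 - t) \<cdot>\<^sub>v y \<in> S)"

definition QCO :: "nat \<Rightarrow> real Matrix.vec set \<Rightarrow> bool" where
  "QCO d K \<longleftrightarrow>
     K \<subseteq> carrier_vec d \<and>
     convex_vec K \<and>
     convex_vec ((\<lambda>\<theta>. Matrix.vec d (\<lambda>j. (vec_index \<theta> j)\<^sup>2)) ` K) \<and>
     (\<forall>\<theta>\<in>K. \<forall>\<eta>. (\<forall>j<d. \<eta> j \<in> {-1, 1}) \<longrightarrow> Matrix.vec d (\<lambda>j. \<eta> j * vec_index \<theta> j) \<in> K)"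


subsection \<open>Kolmogorov width\<close>

definition orth_projections :: "nat \<Rightarrow> nat \<Rightarrow> real mat set" where
  "orth_projections d k =
     {P \<in> carrier_mat d d. P * P = P \<and> transpose_mat P = P \<and> vec_space.rank d P = k}"

text \<open>The value may be infinite, since \<open>K\<close> is not assumed to be bounded.\<close>

definition kolmogorov_width :: "nat \<Rightarrow> real Matrix.vec set \<Rightarrow> nat \<Rightarrow> ennreal" where
  "kolmogorov_width d K k =
     (INF P\<in>orth_projections d k. SUP \<theta>\<in>K. ennreal (vnorm (\<theta> - P *\<^sub>v \<theta>)))"

definition E_raw_sq :: "nat \<Rightarrow> real Matrix.vec set \<Rightarrow> nat \<Rightarrow> real \<Rightarrow> real \<Rightarrow> nat \<Rightarrow> ennreal" where
  \<comment> \<open>At \<open>\<epsilon> = 0\<close> the expression \<open>\<epsilon>\<^sup>2 * ln (1 / \<epsilon>)\<close> evaluates to \<open>0\<close>, as intended.\<close>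
  "E_raw_sq d K N \<sigma> \<epsilon> k =
     (kolmogorov_width d K k)\<^sup>2 +
     ennreal (\<sigma>\<^sup>2 * Max {sqrt (real k) / real N,
                         \<epsilon>\<^sup>2 * ln (1 / \<epsilon>),
                         sqrt (\<epsilon>\<^sup>2 * ln (1 / \<epsilon>) * real k / real N)})"

definition ennsqrt :: "ennreal \<Rightarrow> ennreal" where
  "ennsqrt x = (if x = \<infinity> then \<infinity> else ennreal (sqrt (enn2real x)))"

definition E_raw :: "nat \<Rightarrow> real Matrix.vec set \<Rightarrow> nat \<Rightarrow> real \<Rightarrow> real \<Rightarrow> nat \<Rightarrow> ennreal" where
  "E_raw d K N \<sigma> \<epsilon> k = ennsqrt (E_raw_sq d K N \<sigma> \<epsilon> k)"


subsection \<open>Contamination model and tests\<close>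

text \<open>A data set \<open>x\<close> has the \<open>N\<close> samples \<open>x i\<close>, \<open>i < N\<close>, with coordinates \<open>x i j\<close>, \<open>j < d\<close>.\<close>

type_synonym dataset = "nat \<Rightarrow> nat \<Rightarrow> real"

definition data_space :: "nat \<Rightarrow> nat \<Rightarrow> dataset measure" where
  "data_space d N = (\<Pi>\<^sub>M i\<in>{..<N}. \<Pi>\<^sub>M j\<in>{..<d}. borel)"

text \<open>The law \<open>N(\<mu>, \<sigma>\<^sup>2 I\<^sub>d)\<close>, whose coordinates are independent with laws \<open>N(\<mu>\<^sub>j, \<sigma>\<^sup>2)\<close>.\<close>

definition gaussian :: "nat \<Rightarrow> real Matrix.vec \<Rightarrow> real \<Rightarrow> (nat \<Rightarrow> real) measure" where
  "gaussian d \<mu> \<sigma> =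
     (\<Pi>\<^sub>M j\<in>{..<d}. density lborel (\<lambda>t. ennreal (normal_density (vec_index \<mu> j) \<sigma> t)))"

definition sample_law :: "nat \<Rightarrow> nat \<Rightarrow> real \<Rightarrow> real Matrix.vec \<Rightarrow> dataset measure" where
  "sample_law d N \<sigma> \<mu> = (\<Pi>\<^sub>M i\<in>{..<N}. gaussian d \<mu> \<sigma>)"

text \<open>
  An adversary sees the whole clean data set before corrupting it. It is not required to be a
  measurable map; accordingly the error probabilities below are outer probabilities, which are
  the ordinary ones (\<open>outer_measure_of_eq\<close>) whenever the error event is measurable, and in
  particular whenever the adversary is.
\<close>

definition adversaries :: "nat \<Rightarrow> nat \<Rightarrow> real \<Rightarrow> (dataset \<Rightarrow> dataset) set" where
  "adversaries d N \<epsilon> =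
     {\<C>. \<forall>x\<in>space (data_space d N).
            \<C> x \<in> space (data_space d N) \<and>
            real (card {i\<in>{..<N}. \<C> x i \<noteq> x i}) \<le> \<epsilon> * real N}"

definition tests :: "nat \<Rightarrow> nat \<Rightarrow> (dataset \<Rightarrow> nat) set" where
  "tests d N = measurable (data_space d N) (count_space {0, 1})"

definition err_prob ::
  "nat \<Rightarrow> nat \<Rightarrow> real \<Rightarrow> real Matrix.vec \<Rightarrow> (dataset \<Rightarrow> dataset) \<Rightarrow> (dataset \<Rightarrow> nat) \<Rightarrow> nat \<Rightarrow> ennreal" where
  "err_prob d N \<sigma> \<mu> \<C> \<phi> b =
     outer_measure_of (sample_law d N \<sigma> \<mu>) {x \<in> space (sample_law d N \<sigma> \<mu>). \<phi> (\<C> x) = b}"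

definition type_I_error :: "nat \<Rightarrow> nat \<Rightarrow> real \<Rightarrow> real \<Rightarrow> (dataset \<Rightarrow> nat) \<Rightarrow> ennreal" where
  "type_I_error d N \<sigma> \<epsilon> \<phi> = (SUP \<C>\<in>adversaries d N \<epsilon>. err_prob d N \<sigma> (0\<^sub>v d) \<C> \<phi> 1)"

definition type_II_error ::
  "nat \<Rightarrow> real Matrix.vec set \<Rightarrow> nat \<Rightarrow> real \<Rightarrow> real \<Rightarrow> real \<Rightarrow> (dataset \<Rightarrow> nat) \<Rightarrow> ennreal" where
  "type_II_error d K N \<sigma> \<epsilon> \<rho> \<phi> =
     (SUP \<mu>\<in>{\<mu>\<in>K. vnorm \<mu> \<ge> \<rho>}. SUP \<C>\<in>adversaries d N \<epsilon>. err_prob d N \<sigma> \<mu> \<C> \<phi> 0)"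

definition rho_critical ::
  "nat \<Rightarrow> real Matrix.vec set \<Rightarrow> nat \<Rightarrow> real \<Rightarrow> real \<Rightarrow> real \<Rightarrow> ennreal" where
  "rho_critical d K N \<sigma> \<epsilon> \<alpha> =
     (INF \<rho>\<in>{\<rho>. 0 < \<rho> \<and> (\<exists>\<phi>\<in>tests d N. type_I_error d N \<sigma> \<epsilon> \<phi> \<le> ennreal \<alpha> \<and>
                                         type_II_error d K N \<sigma> \<epsilon> \<rho> \<phi> \<le> ennreal \<alpha>)}. ennreal \<rho>)"

end

theory Submission
  imports Defs
begin

text \<open>
  If \<open>P\<close> is a nearly optimal projection of rank \<open>k\<close>, then averaging over sign changes bounds
  \<open>\<Sum>\<^sub>j (1 - P\<^sub>j\<^sub>j) \<theta>\<^sub>j\<^sup>2\<close> on \<open>K\<close> by the squared width, and \<open>\<Sum>\<^sub>j P\<^sub>j\<^sub>j = k\<close>. Hence the set \<open>J\<close> of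
  coordinates with \<open>P\<^sub>j\<^sub>j > 1/2\<close> has at most \<open>2k\<close> elements and carries all but a multiple of the
  squared width of the energy of any signal. On \<open>J\<close> consider the centred energy
  \<open>T(G) = \<Sum>\<^sub>j (\<Sum>\<^sub>i\<^sub>\<in>\<^sub>G X\<^sub>i\<^sub>j)\<^sup>2 - |G| |J| \<sigma>\<^sup>2\<close> of a set \<open>G\<close> of samples, and accept the null hypothesis if
  some \<open>S\<close> with \<open>|S| \<ge> N - \<epsilon>N\<close> has \<open>T(G) \<le> \<tau>\<close> for all \<open>G \<subseteq> S\<close> with \<open>|G| \<ge> N - 2\<epsilon>N\<close>. This test
  is insensitive to the adversary once the clean sample satisfies \<open>T(G) \<le> \<tau>\<close>, respectively
  \<open>T(G) > \<tau>\<close>, for all such \<open>G\<close> at once. A union bound over the removed block \<open>B\<close> applied to \<open>T(G)\<close>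
  itself is too lossy, so one writes \<open>|Z\<^sub>G|\<^sup>2 = |Z\<^sub>a\<^sub>l\<^sub>l|\<^sup>2 - 2 \<langle>Z\<^sub>G, Z\<^sub>B\<rangle> - |Z\<^sub>B|\<^sup>2\<close> for the noise sums: the
  first term does not depend on \<open>B\<close>, and the other two are small because \<open>B\<close> is.
\<close>

section \<open>Rounding a projection to coordinates\<close>

text \<open>Rank factorisation: the columns of \<open>A\<close> form a basis of the column space, so
  \<open>P = A * B\<close> for some \<open>B\<close>. Idempotence makes \<open>P\<close> fix the
  columns of \<open>A\<close>, hence \<open>A * (B * A) = A\<close>, and as \<open>A\<close> is
  injective, \<open>B * A\<close> is the identity of size \<open>k\<close>. The traces of
  \<open>A * B\<close> and \<open>B * A\<close> agree.\<close>

lemma idempotent_diag_sum: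
  fixes P :: "real mat"
  assumes P: "P \<in> carrier_mat d d" and PP: "P * P = P"
  shows "(\<Sum>j<d. P $$ (j,j)) = real (vec_space.rank d P)"
proof -
  interpret vec_space "TYPE(real)" d .
  let ?Q = "\<lambda>T. T \<subseteq> set (cols P) \<and> lin_indpt T"
  have "?Q {}" by (simp add: finite_lin_indpt2)
  from maximal_exists_superset[of "set (cols P)" ?Q, OF _ _ this]
  obtain S where S: "finite S" "maximal S ?Q" by blast
  have Sc: "S \<subseteq> set (cols P)" and Si: "lin_indpt S" using S(2) unfolding maximal_def by auto
  have mx: "B = S" if "S \<subseteq> B" "B \<subseteq> set (cols P)" "lin_indpt B" for B
    using S(2) that unfolding maximal_def by simp
  have colsP: "set (cols P) \<subseteq> carrier_vec d" using cols_dim P by blast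
  have SV: "S \<subseteq> carrier_vec d" using Sc colsP by simp
  obtain us where us: "distinct us" "set us = S" using finite_distinct_list[OF S(1)] by blast
  define k where "k = length us"
  define A where "A = mat_of_cols d us"
  have A: "A \<in> carrier_mat d k" unfolding A_def k_def by simp
  have usd: "set us \<subseteq> carrier_vec d" using us Sc colsP by auto
  have colsA: "cols A = us" unfolding A_def using usd by (rule cols_mat_of_cols)
  have rk: "rank P = k" using rank_card_indpt[OF P S(2)] us distinct_card[OF us(1)] by (simp add: k_def)
  \<comment> \<open>A column outside the span could be adjoined to \<open>S\<close>, against
    maximality.\<close>
  have ex: "\<exists>b\<in>carrier_vec k. A *\<^sub>v b = col P j" if j: "j < d" for j
  proof -
    have cj: "col P j \<in> set (cols P)"
      using j P nth_mem[of j "cols P"] by simp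
    have cV: "col P j \<in> carrier_vec d" using cj colsP by auto
    have "col P j \<in> span S"
    proof (rule ccontr)
      assume n: "col P j \<notin> span S"
      have cjS: "col P j \<notin> S"
        using n in_own_span[OF SV] by (rule contra_subsetD[rotated])
      have li: "lin_indpt (S \<union> {col P j})"
        using lin_dep_iff_in_span[OF SV Si cV cjS] n by simp
      have "S \<union> {col P j} \<subseteq> set (cols P)" using cj Sc by simp
      with li have "S \<union> {col P j} = S" using Un_upper1 by (intro mx)
      hence "col P j \<in> S" using insertI1[of "col P j" S] by simp
      thus False using cjS by contradiction
    qed
    from finite_in_span[OF S(1) SV this]
    obtain a where a: "lincomb a S = col P j" by (elim exE conjE)
    have "A *\<^sub>v (vec k (\<lambda>i. a (col A i))) = col P j"
      using mat_mult_eq_lincomb[OF A, of a] a us colsA by simp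
    thus ?thesis by (intro bexI[of _ "vec k (\<lambda>i. a (col A i))"]) auto
  qed
  then obtain b where b: "\<And>j. j < d \<Longrightarrow> b j \<in> carrier_vec k" "\<And>j. j < d \<Longrightarrow> A *\<^sub>v b j = col P j"
    by metis
  define B where "B = mat_of_cols k (map b [0..<d])"
  have B: "B \<in> carrier_mat k d"
    using mat_of_cols_carrier(1)[of k "map b [0..<d]"] unfolding B_def by simp
  have colB: "col B j = b j" if "j < d" for j
    using that b(1) unfolding B_def by (subst col_mat_of_cols) auto
  have AB: "A * B = P"
  proof (rule mat_col_eqI)
    fix j assume "j < dim_col P"
    hence j: "j < d" using P by auto
    have "col (A * B) j = A *\<^sub>v col B j" using A B j by (intro col_mult2) auto
    thus "col (A * B) j = col P j" using b(2) colB j by simp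
  qed (use A B P in auto)
  have PA: "P * A = A"
  proof (rule mat_col_eqI)
    fix i assume "i < dim_col A"
    hence i: "i < k" using A by auto
    have "col A i \<in> set (cols A)" using i A nth_mem[of i "cols A"] by simp
    hence "col A i \<in> set (cols P)" using colsA us Sc by auto
    then obtain j where "j < length (cols P)" "col A i = cols P ! j" by (metis in_set_conv_nth)
    hence j: "j < d" "col A i = col P j" using P by simp_all
    have "col (P * A) i = P *\<^sub>v col A i" using P A i by (intro col_mult2) auto
    also have "\<dots> = col (P * P) j" using P j by (subst col_mult2[OF P P]) auto
    finally show "col (P * A) i = col A i" using PP j by simp
  qed (use A P in auto)
  have BA: "B * A = 1\<^sub>m k"
  proof (rule mat_col_eqI)
    fix i assume "i < dim_col (1\<^sub>m k :: real mat)"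
    hence i: "i < k" by simp
    \<comment> \<open>\<open>A\<close> sends this difference of columns of \<open>B * A\<close> and
      of the identity to zero; independence of the columns of \<open>A\<close> makes it
      vanish.\<close>
    let ?v = "col (B * A) i - unit_vec k i"
    have c: "col (B * A) i \<in> carrier_vec k" using B by (intro carrier_vecI) simp
    have "A *\<^sub>v col (B * A) i = col (A * (B * A)) i"
      using A B i by (subst col_mult2[of A d k "B * A" k]) auto
    also have "A * (B * A) = A" using assoc_mult_mat[OF A B A] AB PA by simp
    also have "col A i = A *\<^sub>v unit_vec k i"
      using A i by (intro eq_vecI) (auto simp: scalar_prod_right_unit)
    finally have "A *\<^sub>v ?v = 0\<^sub>v d"
      using mult_minus_distrib_mat_vec[OF A c, of "unit_vec k i"] A by simp
    hence v0: "?v = 0\<^sub>v k"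
      using lin_depI[OF A, of ?v] Si colsA us c by auto
    have "col (B * A) i = unit_vec k i"
    proof (rule eq_vecI)
      fix r assume "r < dim_vec (unit_vec k i :: real Matrix.vec)"
      hence r: "r < k" by simp
      have "vec_index ?v r = 0" using r by (simp add: v0)
      thus "vec_index (col (B * A) i) r = vec_index (unit_vec k i) r" using r by simp
    qed (use B in simp)
    thus "col (B * A) i = col (1\<^sub>m k) i" using i by simp
  qed (use A B in auto)
  have "(\<Sum>j<d. P $$ (j,j)) = (\<Sum>j<d. \<Sum>i<k. A $$ (j,i) * B $$ (i,j))"
    using A B unfolding AB[symmetric] by (intro sum.cong) (auto simp: scalar_prod_def lessThan_atLeast0)
  also have "\<dots> = (\<Sum>i<k. \<Sum>j<d. B $$ (i,j) * A $$ (j,i))"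
    by (subst sum.swap) (simp add: mult.commute)
  also have "\<dots> = (\<Sum>i<k. (B * A) $$ (i,i))"
    using A B by (intro sum.cong) (auto simp: scalar_prod_def lessThan_atLeast0)
  also have "\<dots> = real k" by (simp add: BA)
  finally show ?thesis using rk by simp
qed

text \<open>Over uniform random signs the quadratic form has its trace as mean, so some choice
  reaches it. The choice is greedy: a new sign enters only through the linear term
  \<open>\<eta>' n * c\<close>, its square being one, so it suffices to give it the sign of
  \<open>c\<close>.\<close>

lemma exists_signs_diag_le:
  fixes a :: "nat \<Rightarrow> nat \<Rightarrow> real"
  shows "\<exists>\<eta>. (\<forall>j. \<eta> j \<in> {-1,1::real}) \<and>
           (\<Sum>j<n. a j j) \<le> (\<Sum>i<n. \<Sum>j<n. a i j * \<eta> i * \<eta> j)"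
proof (induction n)
  case 0
  show ?case by (intro exI[of _ "\<lambda>_. 1"]) auto
next
  case (Suc n)
  then obtain \<eta> where e: "\<forall>j. \<eta> j \<in> {-1,1::real}"
    and le: "(\<Sum>j<n. a j j) \<le> (\<Sum>i<n. \<Sum>j<n. a i j * \<eta> i * \<eta> j)" by auto
  define c where "c = (\<Sum>i<n. (a i n + a n i) * \<eta> i)"
  define \<eta>' where "\<eta>' = \<eta>(n := if c \<ge> 0 then 1 else -1)"
  have "(\<Sum>i<Suc n. \<Sum>j<Suc n. a i j * \<eta>' i * \<eta>' j) =
      (\<Sum>i<n. \<Sum>j<n. a i j * \<eta> i * \<eta> j) + \<eta>' n * c + a n n"
    by (auto simp: \<eta>'_def c_def sum.distrib sum_distrib_left algebra_simps sum_negf sum_subtractf)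
  moreover have "\<eta>' n * c \<ge> 0" by (auto simp: \<eta>'_def)
  ultimately have "(\<Sum>j<Suc n. a j j) \<le> (\<Sum>i<Suc n. \<Sum>j<Suc n. a i j * \<eta>' i * \<eta>' j)"
    using le by simp
  moreover have "\<forall>j. \<eta>' j \<in> {-1,1}" using e by (auto simp: \<eta>'_def)
  ultimately show ?case by blast
qed

text \<open>Averaging over sign changes removes the off-diagonal part of \<open>I - P\<close>, so the weights
  \<open>1 - P\<^sub>j\<^sub>j\<close> are all that matters and an arbitrary projection can be rounded to a coordinate one.\<close>

lemma coordinate_projection:
  assumes P: "P \<in> orth_projections d k"
    and sym: "\<And>\<theta> \<eta>. \<theta> \<in> K \<Longrightarrow> \<forall>j<d. \<eta> j \<in> {-1,1::real} \<Longrightarrow> Matrix.vec d (\<lambda>j. \<eta> j * vec_index \<theta> j) \<in> K"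
    and le: "\<And>\<theta>. \<theta> \<in> K \<Longrightarrow> (vnorm (\<theta> - P *\<^sub>v \<theta>))\<^sup>2 \<le> W"
  obtains J where "J \<subseteq> {..<d}" "card J \<le> 2 * k"
    "\<And>\<theta>. \<theta> \<in> K \<Longrightarrow> (\<Sum>j\<in>{..<d} - J. (vec_index \<theta> j)\<^sup>2) \<le> 2 * W"
proof -
  have Pc: "P \<in> carrier_mat d d" and PP: "P * P = P" and PT: "transpose_mat P = P"
    and rk: "vec_space.rank d P = k"
    using P by (auto simp: orth_projections_def)
  \<comment> \<open>The cut at \<open>1/2\<close> serves both sides: the diagonal entries sum to
    \<open>k\<close>, so at most \<open>2 * k\<close> of them exceed it, and off \<open>J\<close>
    the weight \<open>1 - P $$ (j,j)\<close> is at least \<open>1/2\<close>, which costs the factor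
    \<open>2\<close> on \<open>W\<close>.\<close>
  define J where "J = {j\<in>{..<d}. P $$ (j,j) > 1/2}"
  have symP: "P $$ (i,j) = P $$ (j,i)" if "i < d" "j < d" for i j
    using that Pc index_transpose_mat(1)[of i P j] PT by auto
  have PPij: "(\<Sum>l<d. P $$ (l,i) * P $$ (l,j)) = P $$ (i,j)" if "i < d" "j < d" for i j
  proof -
    have "P $$ (i,j) = (P * P) $$ (i,j)" by (simp add: PP)
    also have "\<dots> = (\<Sum>l<d. P $$ (i,l) * P $$ (l,j))"
      using that Pc by (auto simp: scalar_prod_def lessThan_atLeast0)
    finally show ?thesis using symP that by simp
  qed
  \<comment> \<open>A diagonal entry is the squared norm of its column and so dominates its own
    square, which confines it to the unit interval.\<close>
  have diag: "0 \<le> P $$ (j,j)" "P $$ (j,j) \<le> 1" if j: "j < d" for j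
  proof -
    have eq: "P $$ (j,j) = (\<Sum>l<d. (P $$ (l,j))\<^sup>2)"
      using PPij[OF j j] by (simp add: power2_eq_square)
    show p0: "0 \<le> P $$ (j,j)" unfolding eq by (intro sum_nonneg) auto
    have "(P $$ (j,j))\<^sup>2 \<le> P $$ (j,j)"
      unfolding eq by (subst eq[symmetric], rule member_le_sum) (use j in auto)
    hence "\<not> 1 < P $$ (j,j)" using p0 mult_strict_left_mono[of 1 "P $$ (j,j)" "P $$ (j,j)"]
      by (auto simp: power2_eq_square)
    thus "P $$ (j,j) \<le> 1" by simp
  qed
  have "real (card J) * (1/2) = (\<Sum>j\<in>J. 1/2)" by simp
  also have "\<dots> \<le> (\<Sum>j\<in>J. P $$ (j,j))" by (intro sum_mono) (auto simp: J_def)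
  also have "\<dots> \<le> (\<Sum>j<d. P $$ (j,j))" by (intro sum_mono2) (auto simp: J_def diag)
  also have "\<dots> = real k" using idempotent_diag_sum[OF Pc PP] rk by simp
  finally have cJ: "card J \<le> 2 * k" by linarith
  have *: "(\<Sum>j\<in>{..<d} - J. (vec_index \<theta> j)\<^sup>2) \<le> 2 * W" if t: "\<theta> \<in> K" for \<theta>
  proof -
    let ?t = "vec_index \<theta>"
    \<comment> \<open>\<open>D\<close> is the matrix \<open>I - P\<close>. Suitable signs make its
      quadratic form at least the diagonal part, and the flipped vector stays in
      \<open>K\<close>.\<close>
    define D where "D i j = (if i = j then 1 else 0) - P $$ (i,j)" for i j
    obtain \<eta> where e: "\<forall>j. \<eta> j \<in> {-1,1::real}"
      and ge: "(\<Sum>j<d. D j j * ?t j * ?t j) \<le> (\<Sum>i<d. \<Sum>j<d. (D i j * ?t i * ?t j) * \<eta> i * \<eta> j)"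
      using exists_signs_diag_le[where n = d and a = "\<lambda>i j. D i j * ?t i * ?t j"] by blast
    define v where "v j = \<eta> j * ?t j" for j
    define \<psi> where "\<psi> = Matrix.vec d v"
    have "\<psi> \<in> K" unfolding \<psi>_def v_def using sym[OF t] e by auto
    hence "(vnorm (\<psi> - P *\<^sub>v \<psi>))\<^sup>2 \<le> W" by (rule le)
    moreover have "(vnorm (\<psi> - P *\<^sub>v \<psi>))\<^sup>2 = (\<Sum>i<d. \<Sum>j<d. D i j * v i * v j)"
    proof -
      have idx: "vec_index (\<psi> - P *\<^sub>v \<psi>) l = (\<Sum>j<d. D l j * v j)" if l: "l < d" for l
      proof -
        have "vec_index (P *\<^sub>v \<psi>) l = (\<Sum>j<d. P $$ (l,j) * v j)"
          using l Pc by (auto simp: \<psi>_def scalar_prod_def lessThan_atLeast0 intro!: sum.cong)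
        moreover have "(\<Sum>j<d. D l j * v j) = v l - (\<Sum>j<d. P $$ (l,j) * v j)"
        proof -
          have "(\<Sum>j<d. D l j * v j) = (\<Sum>j<d. (if l = j then v j else 0) - P $$ (l,j) * v j)"
            by (intro sum.cong) (auto simp: D_def left_diff_distrib)
          also have "\<dots> = v l - (\<Sum>j<d. P $$ (l,j) * v j)"
            using l by (simp add: sum_subtractf)
          finally show ?thesis .
        qed
        ultimately show ?thesis using l Pc by (simp add: \<psi>_def)
      qed
      \<comment> \<open>\<open>I - P\<close> is a symmetric idempotent, so its quadratic form is the
        squared norm of the residual.\<close>
      have DD: "(\<Sum>l<d. D l i * D l j) = D i j" if ij: "i < d" "j < d" for i j
      proof -
        have "(\<Sum>l<d. D l i * D l j) = (\<Sum>l<d. (if l = i then D l j else 0) -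
            (if l = j then P $$ (l,i) else 0) + P $$ (l,i) * P $$ (l,j))"
          by (intro sum.cong) (auto simp: D_def algebra_simps)
        also have "\<dots> = D i j - P $$ (j,i) + P $$ (i,j)"
          using ij PPij by (simp add: sum.distrib sum_subtractf)
        finally show ?thesis using symP ij by simp
      qed
      have "(vnorm (\<psi> - P *\<^sub>v \<psi>))\<^sup>2 = (\<Sum>l<d. (\<Sum>j<d. D l j * v j)\<^sup>2)"
      proof -
        have "scalar_prod (\<psi> - P *\<^sub>v \<psi>) (\<psi> - P *\<^sub>v \<psi>) = (\<Sum>l<d. (\<Sum>j<d. D l j * v j)\<^sup>2)"
          using Pc idx unfolding scalar_prod_def
          by (intro sum.cong) (auto simp: power2_eq_square lessThan_atLeast0)
        thus ?thesis unfolding vnorm_def by (simp add: sum_nonneg)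
      qed
      also have "\<dots> = (\<Sum>l<d. \<Sum>i<d. \<Sum>j<d. (D l i * D l j) * (v i * v j))"
        by (simp add: power2_eq_square sum_product algebra_simps)
      also have "\<dots> = (\<Sum>i<d. \<Sum>j<d. \<Sum>l<d. (D l i * D l j) * (v i * v j))"
        by (rule trans[OF sum.swap], rule sum.cong[OF refl], rule sum.swap)
      also have "\<dots> = (\<Sum>i<d. \<Sum>j<d. D i j * v i * v j)"
        by (intro sum.cong refl) (simp add: sum_distrib_right[symmetric] DD)
      finally show ?thesis .
    qed
    moreover have "(\<Sum>i<d. \<Sum>j<d. (D i j * ?t i * ?t j) * \<eta> i * \<eta> j) = (\<Sum>i<d. \<Sum>j<d. D i j * v i * v j)"
      by (simp add: v_def algebra_simps)
    ultimately have "(\<Sum>j<d. D j j * ?t j * ?t j) \<le> W" using ge by linarith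
    moreover have "(\<Sum>j\<in>{..<d} - J. (?t j)\<^sup>2 / 2) \<le> (\<Sum>j<d. D j j * ?t j * ?t j)"
    proof -
      have "(\<Sum>j\<in>{..<d} - J. (?t j)\<^sup>2 / 2) \<le> (\<Sum>j\<in>{..<d} - J. D j j * ?t j * ?t j)"
      proof (intro sum_mono)
        fix j assume "j \<in> {..<d} - J"
        hence "D j j \<ge> 1/2" by (auto simp: J_def D_def)
        thus "(?t j)\<^sup>2 / 2 \<le> D j j * ?t j * ?t j"
          using mult_right_mono[of "1/2" "D j j" "(?t j)\<^sup>2"] by (simp add: power2_eq_square algebra_simps)
      qed
      also have "\<dots> \<le> (\<Sum>j<d. D j j * ?t j * ?t j)"
      proof (intro sum_mono2)
        fix j assume "j \<in> {..<d} - ({..<d} - J)"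
        hence "D j j \<ge> 0" using diag by (auto simp: D_def)
        thus "0 \<le> D j j * ?t j * ?t j" by (metis mult.assoc mult_nonneg_nonneg zero_le_square)
      qed auto
      finally show ?thesis .
    qed
    ultimately show ?thesis by (simp add: sum_divide_distrib[symmetric])
  qed
  show thesis by (rule that[OF _ cJ *]) (auto simp: J_def)
qed

section \<open>Tail bounds for Gaussian arrays\<close>

text \<open>Completing the square: the exponential weight turns the centred density into the one
  with mean \<open>x * s\<^sup>2\<close>, which has mass one.\<close>

lemma normal_density_mgf:
  fixes x :: real
  assumes s: "s > 0"
  shows "(\<integral>\<^sup>+y. ennreal (normal_density 0 s y) * ennreal (exp (x * y - x\<^sup>2 * s\<^sup>2 / 2)) \<partial>lborel) = 1"
proof -
  have "normal_density 0 s y * exp (x * y - x\<^sup>2 * s\<^sup>2 / 2) = normal_density (x * s\<^sup>2) s y" for y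
  proof -
    have "-(y\<^sup>2) / (2 * s\<^sup>2) + (x * y - x\<^sup>2 * s\<^sup>2 / 2) = -((y - x * s\<^sup>2)\<^sup>2) / (2 * s\<^sup>2)"
      using s by (simp add: field_simps power2_eq_square)
    thus ?thesis by (simp add: normal_density_def exp_add[symmetric])
  qed
  hence "(\<integral>\<^sup>+y. ennreal (normal_density 0 s y) * ennreal (exp (x * y - x\<^sup>2 * s\<^sup>2 / 2)) \<partial>lborel) =
      (\<integral>\<^sup>+y. ennreal (normal_density (x * s\<^sup>2) s y) \<partial>lborel)"
    by (simp add: ennreal_mult[symmetric])
  also have "\<dots> = ennreal (\<integral>y. normal_density (x * s\<^sup>2) s y \<partial>lborel)"
    using s by (intro nn_integral_eq_integral integrable_normal_density) auto
  finally show ?thesis using s by simp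
qed

text \<open>The weight changes the variance to \<open>s\<^sup>2 / (1 - 2 * t)\<close> and leaves the
  mass \<open>exp (-t) / sqrt (1 - 2 * t)\<close>. The second-order bound for
  \<open>ln (1 + u)\<close> at \<open>u = - 2 * t\<close> holds for
  \<open>\<bar>u\<bar> \<le> 1/2\<close>, whence the range of \<open>t\<close>; half of its error
  \<open>2 * u\<^sup>2\<close> is the exponent \<open>4 * t\<^sup>2\<close>.\<close>

lemma normal_density_mgf_square_le:
  assumes s: "s > 0" and t: "\<bar>t\<bar> \<le> 1/4"
  shows "(\<integral>\<^sup>+y. ennreal (normal_density 0 s y) * ennreal (exp (t * (y\<^sup>2 / s\<^sup>2 - 1))) \<partial>lborel)
      \<le> ennreal (exp (4 * t\<^sup>2))"
proof -
  define a where "a = 1 - 2 * t"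
  define s' where "s' = s / sqrt a"
  have a: "a > 0" using t by (auto simp: a_def)
  have s': "s' > 0" using s a by (simp add: s'_def)
  have sq: "s'\<^sup>2 = s\<^sup>2 / a" using a by (simp add: s'_def power_divide)
  have eq: "normal_density 0 s y * exp (t * (y\<^sup>2 / s\<^sup>2 - 1)) = exp (-t) / sqrt a * normal_density 0 s' y" for y
  proof -
    have "-(y\<^sup>2) / (2 * s\<^sup>2) + t * (y\<^sup>2 / s\<^sup>2 - 1) = - t + -(y\<^sup>2) / (2 * s'\<^sup>2)"
      unfolding sq using s a by (simp add: field_simps a_def)
    moreover have "sqrt (2 * pi * s\<^sup>2) = sqrt a * sqrt (2 * pi * s'\<^sup>2)"
      unfolding sq using a by (simp add: real_sqrt_mult[symmetric])
    ultimately show ?thesis using s a s'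
      by (simp add: normal_density_def exp_add[symmetric] field_simps)
  qed
  have "(\<integral>\<^sup>+y. ennreal (normal_density 0 s y) * ennreal (exp (t * (y\<^sup>2 / s\<^sup>2 - 1))) \<partial>lborel) =
      (\<integral>\<^sup>+y. ennreal (exp (-t) / sqrt a) * ennreal (normal_density 0 s' y) \<partial>lborel)"
    using a by (intro nn_integral_cong) (simp add: ennreal_mult[symmetric] eq)
  also have "\<dots> = ennreal (exp (-t) / sqrt a) * ennreal (\<integral>y. normal_density 0 s' y \<partial>lborel)"
    using s' by (subst nn_integral_cmult, simp, subst nn_integral_eq_integral) auto
  also have "\<dots> = ennreal (exp (-t) / sqrt a)" using s' by simp
  also have "exp (-t) / sqrt a \<le> exp (4 * t\<^sup>2)"
  proof -
    have "\<bar>ln (1 + (- 2 * t)) - (- 2 * t)\<bar> \<le> 2 * (- 2 * t)\<^sup>2"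
      using abs_ln_one_plus_x_minus_x_bound[of "- 2 * t"] t by simp
    hence l: "- t - ln a / 2 \<le> 4 * t\<^sup>2"
      by (simp add: a_def power2_eq_square abs_le_iff)
    have "exp (-t) / sqrt a = exp (- t - ln a / 2)"
      using a by (simp add: exp_diff ln_sqrt[symmetric])
    thus ?thesis using l by simp
  qed
  finally show ?thesis by (simp add: ennreal_leI)
qed

text \<open>Markov's inequality for \<open>exp f\<close>. With the logarithmic moment bound already
  subtracted inside \<open>f\<close>, all tails take the same form \<open>exp (-s)\<close> and can
  enter one union bound.\<close>

lemma (in prob_space) Chernoff_exponent:
  assumes [measurable]: "f \<in> borel_measurable M"
    and le: "(\<integral>\<^sup>+\<omega>. ennreal (exp (f \<omega>)) \<partial>M) \<le> 1"
  shows "emeasure M {\<omega>\<in>space M. s \<le> f \<omega>} \<le> ennreal (exp (-s))"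
proof -
  have "{\<omega>\<in>space M. s \<le> f \<omega>} = {\<omega>\<in>space M. 1 \<le> ennreal (exp (-s)) * ennreal (exp (f \<omega>))}"
    by (auto simp: ennreal_mult[symmetric] exp_add[symmetric] ennreal_1[symmetric] simp del: ennreal_1)
  also have "emeasure M \<dots> \<le> ennreal (exp (-s)) * (\<integral>\<^sup>+\<omega>. ennreal (exp (f \<omega>)) * indicator (space M) \<omega> \<partial>M)"
    by (intro nn_integral_Markov_inequality) auto
  also have "(\<integral>\<^sup>+\<omega>. ennreal (exp (f \<omega>)) * indicator (space M) \<omega> \<partial>M) = (\<integral>\<^sup>+\<omega>. ennreal (exp (f \<omega>)) \<partial>M)"
    by (intro nn_integral_cong) auto
  also have "ennreal (exp (-s)) * \<dots> \<le> ennreal (exp (-s)) * 1"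
    by (intro mult_left_mono le) auto
  finally show ?thesis by simp
qed

section \<open>Arrays of independent standard normal variables and their block sums\<close>

locale std_normal_array = prob_space +
  fixes Z :: "nat \<times> nat \<Rightarrow> 'a \<Rightarrow> real" and I J :: "nat set"
  assumes finI: "finite I" and finJ: "finite J"
    and indep: "indep_vars (\<lambda>_. borel) Z (I \<times> J)"
    and std: "\<And>p. p \<in> I \<times> J \<Longrightarrow> distributed M lborel (Z p) std_normal_density"
begin

definition S :: "nat set \<Rightarrow> nat \<Rightarrow> 'a \<Rightarrow> real" where
  "S B j \<omega> = (\<Sum>i\<in>B. Z (i,j) \<omega>)"

lemma Z_measurable: "p \<in> I \<times> J \<Longrightarrow> Z p \<in> borel_measurable M"
  using indep by (auto simp: indep_vars_def)

lemma S_measurable: "B \<subseteq> I \<Longrightarrow> j \<in> J \<Longrightarrow> S B j \<in> borel_measurable M"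
  unfolding S_def by (intro borel_measurable_sum Z_measurable) auto

lemma S_distributed:
  assumes B: "B \<subseteq> I" "B \<noteq> {}" and j: "j \<in> J"
  shows "distributed M lborel (S B j) (normal_density 0 (sqrt (real (card B))))"
proof -
  have "distributed M lborel (\<lambda>\<omega>. \<Sum>p\<in>B \<times> {j}. Z p \<omega>)
      (normal_density (\<Sum>p\<in>B \<times> {j}. 0) (sqrt (\<Sum>p\<in>B \<times> {j}. 1\<^sup>2)))"
    using B j finI finite_subset
    by (intro sum_indep_normal indep_vars_subset[OF indep] std) auto
  moreover have "(\<lambda>\<omega>. \<Sum>p\<in>B \<times> {j}. Z p \<omega>) = S B j"
    unfolding S_def by (simp add: sum.cartesian_product')
  ultimately show ?thesis by (simp add: card_cartesian_product)
qed

text \<open>For distinct \<open>j\<close> the pairs of block sums are read off disjoint columns of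
  the array and so are independent. Two block sums per column are provided because an inner product
  of block sums involves both.\<close>

lemma column_factor:
  fixes f :: "nat \<Rightarrow> real \<Rightarrow> real \<Rightarrow> ennreal"
  assumes AB: "A \<subseteq> I" "B \<subseteq> I"
    and f: "\<And>j. (\<lambda>(x, y). f j x y) \<in> borel_measurable (borel \<Otimes>\<^sub>M borel)"
  shows "(\<integral>\<^sup>+\<omega>. (\<Prod>j\<in>J. f j (S A j \<omega>) (S B j \<omega>)) \<partial>M) = (\<Prod>j\<in>J. \<integral>\<^sup>+\<omega>. f j (S A j \<omega>) (S B j \<omega>) \<partial>M)"
proof (rule indep_vars_nn_integral)
  let ?R = "\<lambda>j \<omega>. restrict (\<lambda>p. Z p \<omega>) (I \<times> {j})"
  let ?G = "\<lambda>j w. f j (\<Sum>i\<in>A. w (i, j)) (\<Sum>i\<in>B. w (i, j))"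
  have R: "indep_vars (\<lambda>j. PiM (I \<times> {j}) (\<lambda>_. borel)) ?R J"
    by (intro indep_vars_restrict[OF indep]) (auto simp: disjoint_family_on_def)
  have G: "?G j \<in> borel_measurable (PiM (I \<times> {j}) (\<lambda>_. borel))" for j
  proof -
    have "(\<lambda>w. (\<Sum>i\<in>A. w (i, j), \<Sum>i\<in>B. w (i, j))) \<in>
        measurable (PiM (I \<times> {j}) (\<lambda>_. borel :: real measure)) (borel \<Otimes>\<^sub>M borel)"
      using AB by (intro measurable_Pair borel_measurable_sum measurable_component_singleton) auto
    from measurable_compose[OF this f[of j]] show ?thesis by simp
  qed
  have "indep_vars (\<lambda>_. borel) (\<lambda>j \<omega>. ?G j (?R j \<omega>)) J"
    using indep_vars_compose2[OF R, where Y = ?G and N = "\<lambda>_. borel"] G by simp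
  moreover have "?G j (?R j \<omega>) = f j (S A j \<omega>) (S B j \<omega>)" for j \<omega>
  proof -
    have "(\<Sum>i\<in>C. ?R j \<omega> (i, j)) = S C j \<omega>" if "C \<subseteq> I" for C
      unfolding S_def using that by (intro sum.cong) auto
    thus ?thesis using AB by simp
  qed
  ultimately show "indep_vars (\<lambda>_. borel) (\<lambda>j \<omega>. f j (S A j \<omega>) (S B j \<omega>)) J" by simp
qed (use finJ in auto)

lemma S_disjoint_indep:
  assumes AB: "A \<subseteq> I" "B \<subseteq> I" "A \<inter> B = {}" and j: "j \<in> J"
  shows "indep_var borel (S A j) borel (S B j)"
proof -
  let ?R = "\<lambda>C \<omega>. restrict (\<lambda>p. Z p \<omega>) (C \<times> {j})"
  let ?G = "\<lambda>C w. \<Sum>i\<in>C. w (i, j) :: real"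
  have "indep_var (PiM (A \<times> {j}) (\<lambda>_. borel)) (?R A) (PiM (B \<times> {j}) (\<lambda>_. borel)) (?R B)"
    using AB j by (intro indep_var_restrict[OF indep]) auto
  moreover have G: "?G C \<in> borel_measurable (PiM (C \<times> {j}) (\<lambda>_. borel))" for C
    by (intro borel_measurable_sum measurable_component_singleton) auto
  ultimately have "indep_var borel (?G A \<circ> ?R A) borel (?G B \<circ> ?R B)"
    by (intro indep_var_compose[OF _ G G])
  moreover have "?G C \<circ> ?R C = S C j" for C
    unfolding S_def by (auto simp: fun_eq_iff intro!: sum.cong)
  ultimately show ?thesis by simp
qed

text \<open>The exponent is normalised so that, conditionally on the first factors, its exponential
  has mean one; no information on the law of the first factors is needed.\<close>

lemma inner_product_tail:
  assumes AB: "A \<subseteq> I" "B \<subseteq> I" "A \<inter> B = {}" "B \<noteq> {}"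
  shows "emeasure M {\<omega>\<in>space M. s \<le> l * (\<Sum>j\<in>J. (\<nu> j + c * S A j \<omega>) * S B j \<omega>)
      - l\<^sup>2 * real (card B) / 2 * (\<Sum>j\<in>J. (\<nu> j + c * S A j \<omega>)\<^sup>2)} \<le> ennreal (exp (-s))"
proof (rule Chernoff_exponent)
  have [measurable]: "S A j \<in> borel_measurable M" "S B j \<in> borel_measurable M" if "j \<in> J" for j
    using S_measurable AB that by auto
  show "(\<lambda>\<omega>. l * (\<Sum>j\<in>J. (\<nu> j + c * S A j \<omega>) * S B j \<omega>)
      - l\<^sup>2 * real (card B) / 2 * (\<Sum>j\<in>J. (\<nu> j + c * S A j \<omega>)\<^sup>2)) \<in> borel_measurable M"
    by measurable
  define f where "f j x y = ennreal (exp (l * (\<nu> j + c * x) * y - (l * (\<nu> j + c * x))\<^sup>2 * (sqrt (real (card B)))\<^sup>2 / 2))"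
    for j and x y :: real
  have f_meas: "(\<lambda>(x, y). f j x y) \<in> borel_measurable (borel \<Otimes>\<^sub>M borel)" for j
    unfolding f_def by measurable
  have cB: "card B > 0" using AB finite_subset[OF AB(2) finI] by (auto simp: card_gt_0_iff)
  have one: "(\<integral>\<^sup>+\<omega>. f j (S A j \<omega>) (S B j \<omega>) \<partial>M) = 1" if j: "j \<in> J" for j
  proof -
    note [measurable] = S_measurable[OF AB(1) j] S_measurable[OF AB(2) j]
    \<comment> \<open>With the first block sum frozen at \<open>x\<close>, this is the moment
      generating function of a centred normal variable of variance \<open>card B\<close> at
      \<open>l * (\<nu> j + c * x)\<close>, divided by its value. Independence of disjoint blocks
      then permits integrating over \<open>S B j\<close> first.\<close>
    have inner: "(\<integral>\<^sup>+y. f j x y \<partial>distr M borel (S B j)) = 1" for x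
    proof -
      have fx: "f j x \<in> borel_measurable borel" unfolding f_def by measurable
      have "(\<integral>\<^sup>+y. f j x y \<partial>distr M borel (S B j)) = (\<integral>\<^sup>+\<omega>. f j x (S B j \<omega>) \<partial>M)"
        using fx by (subst nn_integral_distr) auto
      also have "\<dots> = (\<integral>\<^sup>+y. ennreal (normal_density 0 (sqrt (real (card B))) y) * f j x y \<partial>lborel)"
        using S_distributed[OF AB(2,4) j] fx by (subst distributed_nn_integral) auto
      also have "\<dots> = 1" unfolding f_def using cB by (intro normal_density_mgf) auto
      finally show ?thesis .
    qed
    have "(\<integral>\<^sup>+\<omega>. f j (S A j \<omega>) (S B j \<omega>) \<partial>M) =
        (\<integral>\<^sup>+z. (case z of (x, y) \<Rightarrow> f j x y) \<partial>distr M (borel \<Otimes>\<^sub>M borel) (\<lambda>\<omega>. (S A j \<omega>, S B j \<omega>)))"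
      using f_meas by (subst nn_integral_distr) auto
    also have "distr M (borel \<Otimes>\<^sub>M borel) (\<lambda>\<omega>. (S A j \<omega>, S B j \<omega>)) =
        distr M borel (S A j) \<Otimes>\<^sub>M distr M borel (S B j)"
      using S_disjoint_indep[OF AB(1-3) j] by (simp add: indep_var_distribution_eq)
    also have "(\<integral>\<^sup>+z. (case z of (x, y) \<Rightarrow> f j x y) \<partial>(distr M borel (S A j) \<Otimes>\<^sub>M distr M borel (S B j))) =
        (\<integral>\<^sup>+x. (\<integral>\<^sup>+y. f j x y \<partial>distr M borel (S B j)) \<partial>distr M borel (S A j))"
    proof -
      interpret A: prob_space "distr M borel (S A j)" by (rule prob_space_distr) simp
      interpret B: prob_space "distr M borel (S B j)" by (rule prob_space_distr) simp
      interpret pair_prob_space "distr M borel (S A j)" "distr M borel (S B j)" ..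
      show ?thesis using f_meas[of j]
        by (subst B.nn_integral_fst[symmetric]) (auto cong: measurable_cong_sets)
    qed
    also have "\<dots> = 1"
    proof -
      interpret A: prob_space "distr M borel (S A j)" by (rule prob_space_distr) simp
      show ?thesis using A.emeasure_space_1 by (simp add: inner)
    qed
    finally show ?thesis .
  qed
  have "ennreal (exp (l * (\<Sum>j\<in>J. (\<nu> j + c * S A j \<omega>) * S B j \<omega>)
      - l\<^sup>2 * real (card B) / 2 * (\<Sum>j\<in>J. (\<nu> j + c * S A j \<omega>)\<^sup>2))) = (\<Prod>j\<in>J. f j (S A j \<omega>) (S B j \<omega>))" for \<omega>
  proof -
    have "l * (\<Sum>j\<in>J. (\<nu> j + c * S A j \<omega>) * S B j \<omega>)
      - l\<^sup>2 * real (card B) / 2 * (\<Sum>j\<in>J. (\<nu> j + c * S A j \<omega>)\<^sup>2) =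
      (\<Sum>j\<in>J. l * (\<nu> j + c * S A j \<omega>) * S B j \<omega> - (l * (\<nu> j + c * S A j \<omega>))\<^sup>2 * (sqrt (real (card B)))\<^sup>2 / 2)"
      by (simp add: sum_distrib_left sum_subtractf power_mult_distrib mult_ac)
    thus ?thesis unfolding f_def by (simp add: exp_sum[OF finJ] prod_ennreal)
  qed
  hence "(\<integral>\<^sup>+\<omega>. ennreal (exp (l * (\<Sum>j\<in>J. (\<nu> j + c * S A j \<omega>) * S B j \<omega>)
      - l\<^sup>2 * real (card B) / 2 * (\<Sum>j\<in>J. (\<nu> j + c * S A j \<omega>)\<^sup>2))) \<partial>M) =
      (\<Prod>j\<in>J. \<integral>\<^sup>+\<omega>. f j (S A j \<omega>) (S B j \<omega>) \<partial>M)"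
    using column_factor[OF AB(1,2), of f, OF f_meas] by simp
  thus "(\<integral>\<^sup>+\<omega>. ennreal (exp (l * (\<Sum>j\<in>J. (\<nu> j + c * S A j \<omega>) * S B j \<omega>)
      - l\<^sup>2 * real (card B) / 2 * (\<Sum>j\<in>J. (\<nu> j + c * S A j \<omega>)\<^sup>2))) \<partial>M) \<le> 1"
    using one by simp
qed

text \<open>\<open>S B j\<close> has variance \<open>card B\<close>, so each normalised and centred
  square contributes at most \<open>4 * t\<^sup>2\<close> to the logarithmic moment generating
  function. The two signs of \<open>t\<close> give upper and lower deviations.\<close>

lemma chi_square_tail:
  assumes B: "B \<subseteq> I" "B \<noteq> {}" and t: "\<bar>t\<bar> \<le> 1/4"
  shows "emeasure M {\<omega>\<in>space M. s \<le> t * ((\<Sum>j\<in>J. (S B j \<omega>)\<^sup>2) / real (card B) - real (card J))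
      - 4 * t\<^sup>2 * real (card J)} \<le> ennreal (exp (-s))"
proof (rule Chernoff_exponent)
  have [measurable]: "S B j \<in> borel_measurable M" if "j \<in> J" for j
    using S_measurable B that by auto
  show "(\<lambda>\<omega>. t * ((\<Sum>j\<in>J. (S B j \<omega>)\<^sup>2) / real (card B) - real (card J)) - 4 * t\<^sup>2 * real (card J))
      \<in> borel_measurable M"
    by measurable
  \<comment> \<open>\<open>f\<close> depends on \<open>y\<close> alone, so
    \<open>column_factor\<close> applies with both blocks equal to \<open>B\<close>.\<close>
  define f where "f j x y = ennreal (exp (t * (y\<^sup>2 / (sqrt (real (card B)))\<^sup>2 - 1)))"
    for j :: nat and x y :: real
  have f_meas: "(\<lambda>(x, y). f j x y) \<in> borel_measurable (borel \<Otimes>\<^sub>M borel)" for j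
    unfolding f_def by measurable
  have cB: "card B > 0" using B finite_subset[OF B(1) finI] by (auto simp: card_gt_0_iff)
  have le: "(\<integral>\<^sup>+\<omega>. f j (S B j \<omega>) (S B j \<omega>) \<partial>M) \<le> ennreal (exp (4 * t\<^sup>2))" if j: "j \<in> J" for j
  proof -
    have fx: "f j 0 \<in> borel_measurable borel" unfolding f_def by measurable
    have "(\<integral>\<^sup>+\<omega>. f j (S B j \<omega>) (S B j \<omega>) \<partial>M) = (\<integral>\<^sup>+\<omega>. f j 0 (S B j \<omega>) \<partial>M)" by (simp add: f_def)
    also have "\<dots> = (\<integral>\<^sup>+y. ennreal (normal_density 0 (sqrt (real (card B))) y) * f j 0 y \<partial>lborel)"
      using S_distributed[OF B j] fx by (subst distributed_nn_integral) simp_all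
    also have "\<dots> \<le> ennreal (exp (4 * t\<^sup>2))"
      unfolding f_def using cB by (intro normal_density_mgf_square_le t) auto
    finally show ?thesis .
  qed
  have "ennreal (exp (t * ((\<Sum>j\<in>J. (S B j \<omega>)\<^sup>2) / real (card B) - real (card J)) - 4 * t\<^sup>2 * real (card J)))
      = ennreal (exp (- 4 * t\<^sup>2 * real (card J))) * (\<Prod>j\<in>J. f j (S B j \<omega>) (S B j \<omega>))" for \<omega>
  proof -
    have "t * ((\<Sum>j\<in>J. (S B j \<omega>)\<^sup>2) / real (card B) - real (card J)) =
      (\<Sum>j\<in>J. t * ((S B j \<omega>)\<^sup>2 / (sqrt (real (card B)))\<^sup>2 - 1))"
      by (simp add: sum_distrib_left[symmetric] sum_subtractf sum_divide_distrib)
    hence "exp (t * ((\<Sum>j\<in>J. (S B j \<omega>)\<^sup>2) / real (card B) - real (card J)) - 4 * t\<^sup>2 * real (card J)) =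
       exp (- 4 * t\<^sup>2 * real (card J)) * (\<Prod>j\<in>J. exp (t * ((S B j \<omega>)\<^sup>2 / (sqrt (real (card B)))\<^sup>2 - 1)))"
      by (simp add: exp_sum[OF finJ, symmetric] exp_add[symmetric])
    thus ?thesis unfolding f_def by (simp add: prod_ennreal ennreal_mult prod_nonneg)
  qed
  hence "(\<integral>\<^sup>+\<omega>. ennreal (exp (t * ((\<Sum>j\<in>J. (S B j \<omega>)\<^sup>2) / real (card B) - real (card J))
        - 4 * t\<^sup>2 * real (card J))) \<partial>M)
      = (\<integral>\<^sup>+\<omega>. ennreal (exp (- 4 * t\<^sup>2 * real (card J))) * (\<Prod>j\<in>J. f j (S B j \<omega>) (S B j \<omega>)) \<partial>M)"
    by simp
  also have "\<dots> = ennreal (exp (- 4 * t\<^sup>2 * real (card J))) * (\<Prod>j\<in>J. \<integral>\<^sup>+\<omega>. f j (S B j \<omega>) (S B j \<omega>) \<partial>M)"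
    using column_factor[OF B(1) B(1), of f, OF f_meas]
    by (subst nn_integral_cmult) (simp_all add: f_def)
  also have "\<dots> \<le> ennreal (exp (- 4 * t\<^sup>2 * real (card J))) * (\<Prod>j\<in>J. ennreal (exp (4 * t\<^sup>2)))"
    by (intro mult_left_mono prod_mono_ennreal le) auto
  also have "\<dots> = 1"
    by (simp add: ennreal_mult[symmetric] ennreal_power exp_of_nat_mult[symmetric] exp_add[symmetric] algebra_simps)
  finally show "(\<integral>\<^sup>+\<omega>. ennreal (exp (t * ((\<Sum>j\<in>J. (S B j \<omega>)\<^sup>2) / real (card B) - real (card J))
        - 4 * t\<^sup>2 * real (card J))) \<partial>M) \<le> 1" .
qed

end

section \<open>Counting removed blocks and joint tail events\<close>

text \<open>Give a subset \<open>B\<close> the weight \<open>\<epsilon> ^ card B\<close>. The total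
  weight is \<open>(1 + \<epsilon>) ^ card I\<close>, at most
  \<open>exp (\<epsilon> * real (card I))\<close>, while each counted subset weighs at least
  \<open>\<epsilon> ^ m\<close>. The factor \<open>3\<close> collects \<open>2\<close> from the
  bound on \<open>m\<close> and \<open>1\<close> from the total weight, using
  \<open>1 \<le> ln (1 / \<epsilon>)\<close>.\<close>

lemma card_bounded_subsets_le:
  fixes \<epsilon> :: real
  assumes I: "finite I" and e: "0 < \<epsilon>" "\<epsilon> \<le> 1" "1 \<le> ln (1 / \<epsilon>)"
    and m: "real m \<le> 2 * (\<epsilon> * real (card I))"
  shows "real (card {B. B \<subseteq> I \<and> card B \<le> m}) \<le> exp (3 * (\<epsilon> * real (card I)) * ln (1 / \<epsilon>))"
proof -
  let ?F = "{B. B \<subseteq> I \<and> card B \<le> m}" and ?r = "\<epsilon> * real (card I)" and ?L = "ln (1 / \<epsilon>)"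
  have "real (card ?F) * \<epsilon> ^ m = (\<Sum>B\<in>?F. \<epsilon> ^ m)" by simp
  also have "\<dots> \<le> (\<Sum>B\<in>?F. \<epsilon> ^ card B)"
    using e by (intro sum_mono power_decreasing) auto
  also have "\<dots> \<le> (\<Sum>B\<in>Pow I. \<epsilon> ^ card B)"
    using I e by (intro sum_mono2) auto
  also have "\<dots> = (\<Prod>i\<in>I. \<epsilon> + 1)"
    using prod_add[OF I, of "\<lambda>_. \<epsilon>" "\<lambda>_. 1"] by simp
  also have "\<dots> \<le> exp \<epsilon> ^ card I"
    using e exp_ge_add_one_self[of \<epsilon>] by (simp add: power_mono add.commute)
  also have "\<dots> = exp ?r" by (simp add: exp_of_nat_mult[symmetric] mult.commute)
  finally have "real (card ?F) \<le> exp ?r / \<epsilon> ^ m" using e by (simp add: field_simps)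
  also have "\<epsilon> ^ m = exp (- (real m * ?L))"
  proof -
    have "\<epsilon> = exp (- ?L)" using e by (simp add: ln_div)
    hence "\<epsilon> ^ m = exp (- ?L) ^ m" by simp
    thus ?thesis by (simp add: exp_of_nat_mult[symmetric])
  qed
  also have "exp ?r / exp (- (real m * ?L)) = exp (?r + real m * ?L)"
    by (simp add: exp_add exp_minus field_simps)
  also have "\<dots> \<le> exp (3 * ?r * ?L)"
  proof -
    have "real m * ?L \<le> 2 * ?r * ?L" using m e by (intro mult_right_mono) auto
    moreover have "?r * 1 \<le> ?r * ?L" using e by (intro mult_left_mono) auto
    ultimately show ?thesis by simp
  qed
  finally show ?thesis .
qed

lemma (in prob_space) union_of_tails:
  assumes F: "finite F"
    and meas: "\<And>x. x \<in> F \<Longrightarrow> f x \<in> borel_measurable M"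
    and tail: "\<And>x. x \<in> F \<Longrightarrow> emeasure M {\<omega>\<in>space M. s x \<le> f x \<omega>} \<le> ennreal (exp (- s x))"
  obtains E where "E \<in> events" "emeasure M E \<le> ennreal (\<Sum>x\<in>F. exp (- s x))"
    "\<And>\<omega> x. \<omega> \<in> space M - E \<Longrightarrow> x \<in> F \<Longrightarrow> f x \<omega> < (s x :: real)"
proof (rule that)
  let ?A = "\<lambda>x. {\<omega>\<in>space M. s x \<le> f x \<omega>}"
  have A: "?A x \<in> events" if "x \<in> F" for x
  proof -
    note [measurable] = meas[OF that]
    show ?thesis by measurable
  qed
  show "(\<Union>x\<in>F. ?A x) \<in> events" using F A by auto
  have "emeasure M (\<Union>x\<in>F. ?A x) \<le> (\<Sum>x\<in>F. emeasure M (?A x))"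
    using F A by (intro emeasure_subadditive_finite) auto
  also have "\<dots> \<le> (\<Sum>x\<in>F. ennreal (exp (- s x)))" by (intro sum_mono tail)
  finally show "emeasure M (\<Union>x\<in>F. ?A x) \<le> ennreal (\<Sum>x\<in>F. exp (- s x))"
    by (simp add: sum_ennreal)
qed (auto simp: not_le)

context std_normal_array begin

text \<open>A single exceptional event covers the full sum at level \<open>s1\<close> and all blocks
  at a separate level \<open>s\<close>, which can be raised to pay for their number. The parameters
  \<open>t1\<close>, \<open>t2\<close>, \<open>l1\<close>, \<open>l2\<close>, \<open>l3\<close> stay
  free, since good values depend on the scale of the term each one controls.\<close>

lemma simultaneous_bounds:
  fixes \<nu> :: "nat \<Rightarrow> real" and m :: nat
  defines "Q \<equiv> \<lambda>B \<omega>. \<Sum>j\<in>J. (S B j \<omega>)\<^sup>2"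
    and "q \<equiv> real (card J)" and "D \<equiv> \<Sum>j\<in>J. (\<nu> j)\<^sup>2"
    and "BB \<equiv> {B. B \<subseteq> I \<and> B \<noteq> {} \<and> card B \<le> m}"
  assumes I: "I \<noteq> {}" and t: "\<bar>t1\<bar> \<le> 1/4" "\<bar>t2\<bar> \<le> 1/4"
  obtains E where "E \<in> events"
    "emeasure M E \<le> ennreal (3 * exp (-s1) + real (card BB) * (5 * exp (-s)))"
    "\<And>\<omega>. \<omega> \<in> space M - E \<Longrightarrow> \<bar>t1 * (Q I \<omega> / real (card I) - q)\<bar> \<le> 4 * t1\<^sup>2 * q + s1"
    "\<And>\<omega>. \<omega> \<in> space M - E \<Longrightarrow> - (l1 * (\<Sum>j\<in>J. \<nu> j * S I j \<omega>)) \<le> l1\<^sup>2 * real (card I) / 2 * D + s1"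
    "\<And>\<omega> B. \<omega> \<in> space M - E \<Longrightarrow> B \<in> BB \<Longrightarrow>
       \<bar>t2 * (Q B \<omega> / real (card B) - q)\<bar> \<le> 4 * t2\<^sup>2 * q + s"
    "\<And>\<omega> B. \<omega> \<in> space M - E \<Longrightarrow> B \<in> BB \<Longrightarrow>
       \<bar>l2 * (\<Sum>j\<in>J. S (I - B) j \<omega> * S B j \<omega>)\<bar> \<le> l2\<^sup>2 * real (card B) / 2 * Q (I - B) \<omega> + s"
    "\<And>\<omega> B. \<omega> \<in> space M - E \<Longrightarrow> B \<in> BB \<Longrightarrow>
       l3 * (\<Sum>j\<in>J. \<nu> j * S B j \<omega>) \<le> l3\<^sup>2 * real (card B) / 2 * D + s"
proof -
  have S_meas: "S B j \<in> borel_measurable M" if "B \<subseteq> I" "j \<in> J" for B j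
    using S_measurable that by auto
  define chi where "chi t B \<omega> = t * (Q B \<omega> / real (card B) - q) - 4 * t\<^sup>2 * q" for t B \<omega>
  define ip where "ip l \<nu> c A B \<omega> = l * (\<Sum>j\<in>J. (\<nu> j + c * S A j \<omega>) * S B j \<omega>)
      - l\<^sup>2 * real (card B) / 2 * (\<Sum>j\<in>J. (\<nu> j + c * S A j \<omega>)\<^sup>2)"
    for l c :: real and \<nu> :: "nat \<Rightarrow> real" and A B \<omega>
  have chi: "emeasure M {\<omega>\<in>space M. s \<le> chi t B \<omega>} \<le> ennreal (exp (-s))"
    if "B \<subseteq> I" "B \<noteq> {}" "\<bar>t\<bar> \<le> 1/4" for t B s
    unfolding chi_def Q_def q_def by (rule chi_square_tail[OF that])
  have ip: "emeasure M {\<omega>\<in>space M. s \<le> ip l \<nu> c A B \<omega>} \<le> ennreal (exp (-s))"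
    if "A \<subseteq> I" "B \<subseteq> I" "A \<inter> B = {}" "B \<noteq> {}" for l c \<nu> A B s
    unfolding ip_def by (rule inner_product_tail[OF that])
  have chi_meas: "chi t B \<in> borel_measurable M" if "B \<subseteq> I" for t B
    unfolding chi_def Q_def using S_meas[OF that] by measurable
  have ip_meas: "ip l \<nu> c A B \<in> borel_measurable M" if "A \<subseteq> I" "B \<subseteq> I" for l c \<nu> A B
    unfolding ip_def using S_meas[OF that(1)] S_meas[OF that(2)] by measurable
  \<comment> \<open>With an empty first block and \<open>c = 0\<close> the inner-product tail
    becomes one for a linear form in the noise; \<open>\<nu>\<close> is negated because the full sum
    needs a lower bound.\<close>
  define f1 where "f1 n = (if n = 0 then chi t1 I else if n = 1 then chi (-t1) I
      else ip l1 (\<lambda>j. - \<nu> j) 0 {} I)" for n :: nat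
  \<comment> \<open>Five tails per block: both signs of the chi-square deviation, both signs of the
    cross term via \<open>c = 1\<close> and \<open>c = -1\<close>, and an upper tail of the linear
    form, since the removed block is subtracted.\<close>
  define f2 where "f2 p = (case p of (B, n) \<Rightarrow>
      if n = 0 then chi t2 B else if n = 1 then chi (-t2) B
      else if n = 2 then ip l2 (\<lambda>_. 0) 1 (I - B) B
      else if n = 3 then ip l2 (\<lambda>_. 0) (-1) (I - B) B
      else ip l3 \<nu> 0 {} B)" for p :: "nat set \<times> nat"
  have finBB: "finite BB" unfolding BB_def using finI by auto
  have f1_meas: "f1 n \<in> borel_measurable M" for n
    unfolding f1_def by (auto intro: chi_meas ip_meas)
  have f1: "emeasure M {\<omega>\<in>space M. s1 \<le> f1 n \<omega>} \<le> ennreal (exp (-s1))" for n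
    using I t unfolding f1_def by (auto intro!: chi ip)
  have f2_meas: "f2 p \<in> borel_measurable M" if "p \<in> BB \<times> {..<5}" for p
  proof -
    have "fst p \<subseteq> I" using that by (auto simp: BB_def)
    thus ?thesis unfolding f2_def by (cases p) (auto intro!: chi_meas ip_meas)
  qed
  have f2: "emeasure M {\<omega>\<in>space M. s \<le> f2 p \<omega>} \<le> ennreal (exp (-s))" if "p \<in> BB \<times> {..<5}" for p
  proof -
    have "fst p \<subseteq> I" "fst p \<noteq> {}" using that by (auto simp: BB_def)
    thus ?thesis using t unfolding f2_def by (cases p) (auto intro!: chi ip)
  qed
  obtain E1 where E1: "E1 \<in> events" "emeasure M E1 \<le> ennreal (\<Sum>n\<in>{..<3::nat}. exp (- s1))"
      "\<And>\<omega> n. \<omega> \<in> space M - E1 \<Longrightarrow> n \<in> {..<3} \<Longrightarrow> f1 n \<omega> < s1"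
    by (rule union_of_tails[of "{..<3}" f1 "\<lambda>_. s1", OF _ f1_meas f1]) auto
  obtain E2 where E2: "E2 \<in> events" "emeasure M E2 \<le> ennreal (\<Sum>p\<in>BB \<times> {..<5::nat}. exp (- s))"
      "\<And>\<omega> p. \<omega> \<in> space M - E2 \<Longrightarrow> p \<in> BB \<times> {..<5} \<Longrightarrow> f2 p \<omega> < s"
    by (rule union_of_tails[of "BB \<times> {..<5}" f2 "\<lambda>_. s", OF _ f2_meas f2]) (use finBB in auto)
  show thesis
  proof (rule that[of "E1 \<union> E2"])
    show "E1 \<union> E2 \<in> events" using E1 E2 by auto
    have "emeasure M (E1 \<union> E2) \<le> emeasure M E1 + emeasure M E2"
      using E1 E2 by (intro emeasure_subadditive) auto
    also have "\<dots> \<le> ennreal (3 * exp (-s1)) + ennreal (real (card BB) * (5 * exp (-s)))"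
      using E1(2) E2(2) by (intro add_mono) (simp_all add: card_cartesian_product mult.assoc)
    finally show "emeasure M (E1 \<union> E2) \<le> ennreal (3 * exp (-s1) + real (card BB) * (5 * exp (-s)))"
      by (simp add: ennreal_plus)
  next
    fix \<omega> assume w: "\<omega> \<in> space M - (E1 \<union> E2)"
    have "f1 0 \<omega> < s1" "f1 1 \<omega> < s1" "f1 2 \<omega> < s1" using E1(3) w by auto
    thus "\<bar>t1 * (Q I \<omega> / real (card I) - q)\<bar> \<le> 4 * t1\<^sup>2 * q + s1"
      and "- (l1 * (\<Sum>j\<in>J. \<nu> j * S I j \<omega>)) \<le> l1\<^sup>2 * real (card I) / 2 * D + s1"
      by (auto simp: f1_def chi_def ip_def abs_le_iff D_def sum_negf)
  next
    fix \<omega> B assume w: "\<omega> \<in> space M - (E1 \<union> E2)" and B: "B \<in> BB"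
    have *: "f2 (B, n) \<omega> < s" if "n < 5" for n using E2(3)[of \<omega> "(B, n)"] w B that by auto
    show "\<bar>t2 * (Q B \<omega> / real (card B) - q)\<bar> \<le> 4 * t2\<^sup>2 * q + s"
      using *[of 0] *[of 1] by (auto simp: f2_def chi_def abs_le_iff)
    show "\<bar>l2 * (\<Sum>j\<in>J. S (I - B) j \<omega> * S B j \<omega>)\<bar> \<le> l2\<^sup>2 * real (card B) / 2 * Q (I - B) \<omega> + s"
      using *[of 2] *[of 3] by (auto simp: f2_def ip_def abs_le_iff Q_def sum_negf)
    show "l3 * (\<Sum>j\<in>J. \<nu> j * S B j \<omega>) \<le> l3\<^sup>2 * real (card B) / 2 * D + s"
      using *[of 4] by (auto simp: f2_def ip_def D_def)
  qed
qed

end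

section \<open>Combining the deviation bounds\<close>

lemma one_le_ln_divide:
  fixes x y :: real
  assumes "0 < x" "3 * x \<le> y"
  shows "1 \<le> ln (y / x)"
proof -
  have "exp 1 \<le> (3::real)" by (rule exp_le)
  also have "\<dots> \<le> y / x" using assms by (simp add: field_simps)
  finally show ?thesis using assms by (simp add: ln_ge_iff)
qed

text \<open>At the parameter \<open>1 / (4 * sqrt k)\<close> the quadratic cost is at most
  \<open>1/2\<close>, so \<open>Q / n\<close> deviates by the order of \<open>sqrt k\<close>, the
  fluctuation of a chi-square variable with at most \<open>2 * k\<close> degrees of freedom.\<close>

lemma gram_deviation_bound:
  fixes n k q s1 t Q :: real
  assumes n: "n > 0" and k: "1 \<le> k" and q: "0 \<le> q" "q \<le> 2 * k" and s1: "0 \<le> s1"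
    and dev: "\<bar>1 / (4 * sqrt k) * (Q / n - q)\<bar> \<le> 4 * (1 / (4 * sqrt k))\<^sup>2 * q + s1"
  shows "\<bar>Q - n * q\<bar> \<le> (2 + 4 * s1) * (n * sqrt k)"
proof -
  define z where "z = sqrt k"
  have z: "z > 0" "k = z\<^sup>2" using k by (simp_all add: z_def)
  have "\<bar>Q / n - q\<bar> / (4 * z) \<le> 4 * (1 / (4 * z))\<^sup>2 * q + s1"
    using dev z by (simp add: z_def[symmetric] abs_mult abs_divide)
  also have "\<dots> \<le> 4 * (1 / (4 * z))\<^sup>2 * (2 * z\<^sup>2) + s1"
    using q z by (intro add_right_mono mult_left_mono) auto
  also have "\<dots> = 1/2 + s1" using z by (simp add: field_simps power2_eq_square)
  finally have "\<bar>Q / n - q\<bar> \<le> (2 + 4 * s1) * z"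
    using z by (simp add: field_simps)
  moreover have "\<bar>Q - n * q\<bar> = n * \<bar>Q / n - q\<bar>"
    using n by (simp add: abs_if field_simps)
  ultimately show ?thesis using n by (simp add: z_def mult_ac mult_left_mono)
qed

text \<open>The parameter balances \<open>s / t\<close> against \<open>t * q\<close> within
  \<open>t \<le> 1/4\<close>: it is of order \<open>y / z\<close> in the Gaussian regime
  \<open>y \<le> z\<close> and of constant order in the exponential regime \<open>z \<le> y\<close>.
  The resulting deviation of \<open>Q / b\<close>, of order \<open>y * z + y\<^sup>2\<close>, is
  multiplied by the block size, at most \<open>2 * r\<close>.\<close>

lemma small_block_deviation_bound:
  fixes b k q r L \<kappa> s Q y z :: real
  assumes b: "0 < b" "b \<le> 2 * r" and k: "z \<ge> 0" "k = z\<^sup>2" and q: "0 \<le> q" "q \<le> 2 * k"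
    and y: "y > 0" "y\<^sup>2 = r * L" and s: "s \<le> \<kappa> * (r * L)" and \<kappa>: "0 \<le> \<kappa>"
    and t: "t = y / (4 * (y + z))"
    and dev: "\<bar>t * (Q / b - q)\<bar> \<le> 4 * t\<^sup>2 * q + s"
  shows "\<bar>Q - b * q\<bar> \<le> r * ((4 + 8 * \<kappa>) * (y * z) + 8 * \<kappa> * y\<^sup>2)"
proof -
  have t0: "t > 0" using y k t by (simp add: add_pos_nonneg)
  have yz: "y + z > 0" using y k by linarith
  have tle: "4 * t * (y + z) = y" using yz by (simp add: t field_simps)
  have "t * \<bar>Q / b - q\<bar> \<le> 4 * t\<^sup>2 * q + s" using dev t0 by (simp add: abs_mult)
  also have "\<dots> \<le> 4 * t\<^sup>2 * (2 * z\<^sup>2) + \<kappa> * y\<^sup>2"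
    using q k s y by (intro add_mono mult_left_mono) auto
  also have "\<dots> = t * (8 * t * z * z + 4 * \<kappa> * y * (y + z))"
  proof -
    have "\<kappa> * y\<^sup>2 = \<kappa> * y * (4 * t * (y + z))" by (simp add: tle power2_eq_square)
    thus ?thesis by (simp add: power2_eq_square algebra_simps)
  qed
  finally have "\<bar>Q / b - q\<bar> \<le> 8 * t * z * z + 4 * \<kappa> * y * (y + z)"
    using t0 by simp
  also have "\<dots> \<le> 2 * y * z + 4 * \<kappa> * y * (y + z)"
  proof -
    have "4 * t * z \<le> y" using tle t0 y by (simp add: distrib_left) (smt (verit) mult_pos_pos)
    hence "4 * t * z * z \<le> y * z" using k by (intro mult_right_mono) auto
    thus ?thesis by simp
  qed
  finally have le: "\<bar>Q / b - q\<bar> \<le> 2 * y * z + 4 * \<kappa> * y * (y + z)" .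
  have "\<bar>Q - b * q\<bar> = b * \<bar>Q / b - q\<bar>" using b by (simp add: abs_if field_simps)
  also have "\<dots> \<le> 2 * r * (2 * y * z + 4 * \<kappa> * y * (y + z))"
    using b le by (intro mult_mono) auto
  finally show ?thesis by (simp add: algebra_simps power2_eq_square)
qed

text \<open>\<open>V\<close> dominates \<open>sqrt G\<close> up to a constant, so the parameter
  \<open>sqrt L / V\<close> makes both the quadratic cost and \<open>s\<close> of order
  \<open>r * L\<close>. Dividing by the parameter leaves \<open>r * sqrt L * V\<close>, which
  expands to the two terms of the bound.\<close>

lemma cross_term_bound:
  fixes b k r n L \<kappa> \<kappa>2 s G X V :: real
  assumes b: "0 < b" "b \<le> 2 * r" and nk: "n \<ge> 0" "k \<ge> 0" and L: "0 < L"
    and s: "s \<le> \<kappa> * (r * L)"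
    and V: "V = sqrt (n * k) + r * sqrt L"
    and G: "G \<le> \<kappa>2 * (n * k + r\<^sup>2 * L)" and \<kappa>2: "0 \<le> \<kappa>2"
    and dev: "\<bar>sqrt L / V * X\<bar> \<le> (sqrt L / V)\<^sup>2 * b / 2 * G + s"
  shows "\<bar>X\<bar> \<le> (\<kappa> + \<kappa>2) * (r * sqrt (n * L * k) + r\<^sup>2 * L)"
proof -
  define l where "l = sqrt L"
  have l: "l > 0" "L = l\<^sup>2" using L by (simp_all add: l_def)
  have r: "r > 0" using b by simp
  have V0: "V > 0" using r l nk by (simp add: V l_def[symmetric] add_nonneg_pos)
  have "n * k + r\<^sup>2 * L \<le> V\<^sup>2"
    using nk l r by (simp add: V l_def[symmetric] power2_sum power_mult_distrib)
  hence G': "G \<le> \<kappa>2 * V\<^sup>2" using G \<kappa>2 by (meson mult_left_mono order_trans)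
  have "l / V * \<bar>X\<bar> \<le> (l / V)\<^sup>2 * b / 2 * G + s"
    using dev l V0 by (simp add: l_def[symmetric] abs_mult)
  also have "\<dots> \<le> (l / V)\<^sup>2 * b / 2 * (\<kappa>2 * V\<^sup>2) + \<kappa> * (r * l\<^sup>2)"
    using G' s b l by (intro add_mono mult_left_mono) auto
  also have "\<dots> = l\<^sup>2 * (b / 2) * \<kappa>2 + \<kappa> * r * l\<^sup>2"
    using V0 by (simp add: power_divide)
  also have "\<dots> \<le> l\<^sup>2 * r * \<kappa>2 + \<kappa> * r * l\<^sup>2"
    using b \<kappa>2 by (intro add_right_mono mult_right_mono mult_left_mono) auto
  also have "\<dots> = l / V * ((\<kappa> + \<kappa>2) * r * l * V)"
    using V0 by (simp add: field_simps power2_eq_square)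
  finally have "\<bar>X\<bar> \<le> (\<kappa> + \<kappa>2) * r * l * V"
    using l V0 by (subst (asm) mult_le_cancel_left_pos) auto
  also have "\<dots> = (\<kappa> + \<kappa>2) * (r * sqrt (n * L * k) + r\<^sup>2 * L)"
  proof -
    have sq: "sqrt (n * L * k) = l * sqrt (n * k)" by (simp add: l_def real_sqrt_mult)
    have V': "V = sqrt (n * k) + r * l" by (simp add: V l_def)
    show ?thesis unfolding sq V' unfolding l(2) by (simp add: algebra_simps power2_eq_square)
  qed
  finally show ?thesis .
qed

text \<open>With \<open>\<kappa> = 3 + s\<close>, the contributions to \<open>dev_const\<close> come in this order from the full sum, the cross
  term and the removed block; \<open>sep_const\<close> lets the signal beat the noise and the linear term.\<close>

definition dev_const :: "real \<Rightarrow> real" where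
  "dev_const s = 2 + 4 * s + 4 * (3 + s + (20 + 8 * s + 24 * (3 + s))) + 4 + 16 * (3 + s)"

definition sep_const :: "real \<Rightarrow> real" where
  "sep_const s = 640 * (s + (3 + s)) + 10 * dev_const s"

text \<open>Centring \<open>QI = QG + 2 * X + QB\<close> term by term reduces the deviation of
  \<open>QG\<close> to those of \<open>QI\<close>, \<open>X\<close> and \<open>QB\<close>. With
  \<open>r = \<epsilon> * n\<close>, the three lower bounds on \<open>h\<close> say that
  \<open>n\<^sup>2 * h\<close> dominates the scales \<open>n * sqrt k\<close>,
  \<open>r\<^sup>2 * L\<close> and \<open>r * sqrt (n * L * k)\<close> that occur.\<close>

lemma block_removed_deviation_bound:
  fixes n k q s1 \<epsilon> h L b s QI QB QG X :: real
  assumes n: "1 \<le> n" and k: "1 \<le> k" and q: "0 \<le> q" "q \<le> 2 * k" and s1: "1 \<le> s1"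
    and e: "0 < \<epsilon>" "\<epsilon> \<le> 1" "1 \<le> \<epsilon> * n" and L: "1 \<le> L"
    and h: "sqrt k / n \<le> h" "\<epsilon>\<^sup>2 * L \<le> h" "sqrt (\<epsilon>\<^sup>2 * L * k / n) \<le> h"
    and b: "0 < b" "b \<le> 2 * (\<epsilon> * n)"
    and s: "s = 3 * (\<epsilon> * n) * L + s1"
    and QI: "QI = QG + 2 * X + QB" "QG \<le> 2 * QI + 2 * QB"
    and devI: "\<bar>1 / (4 * sqrt k) * (QI / n - q)\<bar> \<le> 4 * (1 / (4 * sqrt k))\<^sup>2 * q + s1"
    and t: "t = sqrt (\<epsilon> * n * L) / (4 * (sqrt (\<epsilon> * n * L) + sqrt k))"
    and devB: "\<bar>t * (QB / b - q)\<bar> \<le> 4 * t\<^sup>2 * q + s"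
    and l: "l = sqrt L / (sqrt (n * k) + \<epsilon> * n * sqrt L)"
    and devX: "\<bar>l * X\<bar> \<le> l\<^sup>2 * b / 2 * QG + s"
  shows "\<bar>QG - (n - b) * q\<bar> \<le> dev_const s1 * (n\<^sup>2 * h)"
proof -
  define r where "r = \<epsilon> * n"
  define \<kappa> where "\<kappa> = 3 + s1"
  define \<kappa>2 where "\<kappa>2 = 20 + 8 * s1 + 24 * \<kappa>"
  define H where "H = n\<^sup>2 * h"
  define y where "y = sqrt (r * L)"
  define z where "z = sqrt k"
  have r: "1 \<le> r" "r \<le> n" using e n by (simp_all add: r_def mult_le_cancel_right1)
  have \<kappa>: "0 \<le> \<kappa>" "0 \<le> \<kappa>2" using s1 by (simp_all add: \<kappa>_def \<kappa>2_def)
  have y: "y > 0" "y\<^sup>2 = r * L" using r L by (simp_all add: y_def)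
  have z: "1 \<le> z" "k = z\<^sup>2" "z \<le> k" using k by (simp_all add: z_def sqrt_le_D real_le_lsqrt self_le_power)
  have rL: "1 \<le> r * L" using r L mult_mono[of 1 r 1 L] by simp
  \<comment> \<open>Since \<open>r\<close> and \<open>L\<close> are at least one, the confidence
    term \<open>s1\<close> is absorbed into a multiple of \<open>r * L\<close>.\<close>
  have s_le: "s \<le> \<kappa> * (r * L)"
    using rL s1 mult_left_mono[of 1 "r * L" s1] by (simp add: s \<kappa>_def r_def algebra_simps)
  have H1: "n * z \<le> H"
  proof -
    have "n * z = n\<^sup>2 * (sqrt k / n)" using n by (simp add: z_def power2_eq_square)
    thus ?thesis using mult_left_mono[OF h(1), of "n\<^sup>2"] by (simp add: H_def)
  qed
  have H2: "r\<^sup>2 * L \<le> H"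
    using mult_left_mono[OF h(2), of "n\<^sup>2"] by (simp add: H_def r_def power_mult_distrib mult_ac)
  have H3: "r * sqrt (n * L * k) \<le> H"
  proof -
    have "(n\<^sup>2 * sqrt (\<epsilon>\<^sup>2 * L * k / n))\<^sup>2 = (r * sqrt (n * L * k))\<^sup>2"
      using n L k by (simp add: power_mult_distrib r_def field_simps)
        (simp add: power4_eq_xxxx power2_eq_square)
    hence "n\<^sup>2 * sqrt (\<epsilon>\<^sup>2 * L * k / n) = r * sqrt (n * L * k)"
      using n L k r by (subst (asm) power2_eq_iff_nonneg) auto
    thus ?thesis using mult_left_mono[OF h(3), of "n\<^sup>2"] by (simp add: H_def)
  qed
  \<comment> \<open>The chi-square fluctuation of the block is dominated by the scale of the cross
    term because \<open>r \<le> n\<close>.\<close>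
  have H4: "r * (y * z) \<le> H"
  proof -
    have "y * z = sqrt (r * L * k)" by (simp add: y_def z_def real_sqrt_mult)
    also have "\<dots> \<le> sqrt (n * L * k)" using r L k by (intro real_sqrt_le_mono mult_right_mono) auto
    finally show ?thesis using H3 r mult_left_mono[of "y * z" "sqrt (n * L * k)" r] by linarith
  qed
  have I0: "\<bar>QI - n * q\<bar> \<le> (2 + 4 * s1) * (n * z)"
    unfolding z_def using n k q s1 devI by (intro gram_deviation_bound) auto
  have B0: "\<bar>QB - b * q\<bar> \<le> r * ((4 + 8 * \<kappa>) * (y * z) + 8 * \<kappa> * y\<^sup>2)"
  proof -
    have b': "b \<le> 2 * r" using b by (simp add: r_def)
    have z0: "0 \<le> z" using z by simp
    have t': "t = y / (4 * (y + z))" by (simp add: t y_def z_def r_def)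
    show ?thesis by (rule small_block_deviation_bound[OF b(1) b' z0 z(2) q y s_le \<kappa>(1) t' devB])
  qed
  have I1: "\<bar>QI - n * q\<bar> \<le> (2 + 4 * s1) * H"
    using I0 mult_left_mono[OF H1, of "2 + 4 * s1"] s1 by linarith
  have B1: "\<bar>QB - b * q\<bar> \<le> (4 + 16 * \<kappa>) * H"
  proof -
    have "r * ((4 + 8 * \<kappa>) * (y * z) + 8 * \<kappa> * y\<^sup>2) = (4 + 8 * \<kappa>) * (r * (y * z)) + 8 * \<kappa> * (r\<^sup>2 * L)"
      unfolding y(2) by (simp add: algebra_simps power2_eq_square)
    also have "\<dots> \<le> (4 + 8 * \<kappa>) * H + 8 * \<kappa> * H"
      using \<kappa> H2 H4 by (intro add_mono mult_left_mono) auto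
    finally show ?thesis using B0 by (simp add: algebra_simps)
  qed
  \<comment> \<open>The cross-term bound needs an a priori bound on \<open>QG\<close>. To avoid
    circularity it is taken from the crude inequality in \<open>QI\<close> and \<open>QB\<close>,
    with \<open>2 * (y * z) \<le> y\<^sup>2 + z\<^sup>2\<close> separating the scales.\<close>
  have QG: "QG \<le> \<kappa>2 * (n * k + r\<^sup>2 * L)"
  proof -
    have "n * q \<le> 2 * (n * k)" using q n mult_left_mono[of q "2 * k" n] by simp
    moreover have "(2 + 4 * s1) * (n * z) \<le> (2 + 4 * s1) * (n * k)"
      using z n s1 by (intro mult_left_mono) auto
    ultimately have I2: "QI \<le> (4 + 4 * s1) * (n * k)" using I0 by (simp add: algebra_simps abs_le_iff)
    have bq: "b * q \<le> 4 * (r * k)" using b q k mult_mono[of b "2 * r" q "2 * k"] by (simp add: r_def)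
    have "2 * (y * z) \<le> r * L + k" using sum_squares_bound[of y z] y z by (simp add: algebra_simps)
    hence *: "(2 + 4 * \<kappa>) * r * (2 * (y * z)) \<le> (2 + 4 * \<kappa>) * r * (r * L + k)"
      using \<kappa> r by (intro mult_left_mono) auto
    have "QB \<le> (6 + 12 * \<kappa>) * (r * k) + (2 + 12 * \<kappa>) * (r * (r * L))"
    proof -
      have "0 \<le> \<kappa> * (r * k)" using \<kappa> r k by simp
      thus ?thesis using * B0 bq unfolding y(2) by (simp add: algebra_simps abs_le_iff)
    qed
    also have "\<dots> \<le> (6 + 12 * \<kappa>) * (n * k) + (6 + 12 * \<kappa>) * (r\<^sup>2 * L)"
    proof -
      have "r * (r * L) = r\<^sup>2 * L" by (simp add: power2_eq_square)
      thus ?thesis using \<kappa> r k L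
        by (simp only:) (intro add_mono mult_right_mono mult_left_mono, auto)
    qed
    finally have "2 * QI + 2 * QB \<le> (8 + 8 * s1 + 12 + 24 * \<kappa>) * (n * k) + (12 + 24 * \<kappa>) * (r\<^sup>2 * L)"
      using I2 by (simp add: algebra_simps)
    also have "\<dots> \<le> \<kappa>2 * (n * k) + \<kappa>2 * (r\<^sup>2 * L)"
      using \<kappa> s1 r n k L by (intro add_mono mult_right_mono) (auto simp: \<kappa>2_def)
    finally show ?thesis using QI(2) by (simp add: algebra_simps)
  qed
  have "\<bar>X\<bar> \<le> (\<kappa> + \<kappa>2) * (r * sqrt (n * L * k) + r\<^sup>2 * L)"
  proof (rule cross_term_bound[OF b(1) _ _ _ _ s_le refl QG \<kappa>(2)])
    show "\<bar>sqrt L / (sqrt (n * k) + r * sqrt L) * X\<bar> \<le>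
        (sqrt L / (sqrt (n * k) + r * sqrt L))\<^sup>2 * b / 2 * QG + s"
      using devX by (simp add: l r_def)
  qed (use b n k L in \<open>auto simp: r_def\<close>)
  also have "\<dots> \<le> (\<kappa> + \<kappa>2) * (2 * H)"
    using \<kappa> H2 H3 by (intro mult_left_mono) auto
  finally have X1: "\<bar>X\<bar> \<le> (\<kappa> + \<kappa>2) * (2 * H)" .
  have "QG - (n - b) * q = (QI - n * q) - 2 * X - (QB - b * q)"
    using QI(1) by (simp add: algebra_simps)
  also have "\<bar>\<dots>\<bar> \<le> \<bar>QI - n * q\<bar> + 2 * \<bar>X\<bar> + \<bar>QB - b * q\<bar>" by linarith
  also have "\<dots> \<le> (2 + 4 * s1) * H + 2 * ((\<kappa> + \<kappa>2) * (2 * H)) + (4 + 16 * \<kappa>) * H"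
    using I1 X1 B1 by linarith
  also have "\<dots> = dev_const s1 * H"
    by (simp add: dev_const_def \<kappa>2_def \<kappa>_def algebra_simps)
  finally show ?thesis by (simp add: H_def)
qed

text \<open>The parameters \<open>1 / 64\<close> and \<open>1 / (64 * \<epsilon>)\<close> make the
  quadratic costs \<open>n * D / 128\<close> and at most \<open>n * D / 64\<close>, a small part of
  the signal once multiplied by the sample size. A block has at most
  \<open>2 * (\<epsilon> * n)\<close> samples, which permits a parameter larger by
  \<open>1 / \<epsilon>\<close>, so that its level costs only a multiple of
  \<open>n * (\<epsilon>\<^sup>2 * L) \<le> n * h\<close>.\<close>

lemma linear_term_bound:
  fixes n s1 \<epsilon> h L b s U B D k :: real
  assumes n: "1 \<le> n" and k: "1 \<le> k" and e: "0 < \<epsilon>" "1 \<le> \<epsilon> * n" and L: "1 \<le> L" and s1: "1 \<le> s1"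
    and h: "sqrt k / n \<le> h" "\<epsilon>\<^sup>2 * L \<le> h"
    and b: "0 < b" "b \<le> 2 * (\<epsilon> * n)" and D: "0 \<le> D"
    and s: "s = 3 * (\<epsilon> * n) * L + s1"
    and devU: "- (1 / 64 * U) \<le> (1 / 64)\<^sup>2 * n / 2 * D + s1"
    and devB: "1 / (64 * \<epsilon>) * B \<le> (1 / (64 * \<epsilon>))\<^sup>2 * b / 2 * D + s"
  shows "- (64 * (s1 + (3 + s1)) * (n * h) + 3 / 128 * (n * D)) \<le> U - B"
proof -
  define r where "r = \<epsilon> * n"
  have "1 \<le> sqrt k" using k by simp
  also have "\<dots> \<le> n * h" using h n by (simp add: field_simps)
  finally have nh: "1 \<le> n * h" .
  have r: "1 \<le> r" using e by (simp add: r_def)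
  have rL: "1 \<le> r * L" using r L mult_mono[of 1 r 1 L] by simp
  have s_le: "s \<le> (3 + s1) * (r * L)"
    using rL s1 mult_left_mono[of 1 "r * L" s1] by (simp add: s r_def algebra_simps)
  have "- U \<le> 64 * ((1 / 64)\<^sup>2 * n / 2 * D + s1)"
    using mult_left_mono[OF devU, of 64] by simp
  also have "\<dots> = n * D / 128 + 64 * s1" by (simp add: power2_eq_square)
  also have "64 * s1 \<le> 64 * s1 * (n * h)" using nh s1 by simp
  finally have U: "- U \<le> n * D / 128 + 64 * s1 * (n * h)" by simp
  have "B = 64 * \<epsilon> * (1 / (64 * \<epsilon>) * B)" using e by simp
  also have "\<dots> \<le> 64 * \<epsilon> * ((1 / (64 * \<epsilon>))\<^sup>2 * b / 2 * D + (3 + s1) * (r * L))"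
    using devB s_le e by (intro mult_left_mono) auto
  also have "\<dots> = b * D / (128 * \<epsilon>) + 64 * (3 + s1) * (n * (\<epsilon>\<^sup>2 * L))"
    using e by (simp add: field_simps power2_eq_square r_def)
  also have "\<dots> \<le> (2 * (\<epsilon> * n)) * D / (128 * \<epsilon>) + 64 * (3 + s1) * (n * h)"
    using b e D h n s1 by (intro add_mono divide_right_mono mult_right_mono mult_left_mono) auto
  also have "(2 * (\<epsilon> * n)) * D / (128 * \<epsilon>) = n * D / 64" using e by simp
  finally have "B \<le> n * D / 64 + 64 * (3 + s1) * (n * h)" .
  with U show ?thesis by (simp add: algebra_simps)
qed

text \<open>The larger side is the centred squared norm of signal plus noise summed over
  \<open>g\<close> samples. As \<open>n \<le> 2 * g\<close>, the linear term takes at most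
  \<open>3/32\<close> of \<open>g\<^sup>2 * D\<close> besides a multiple of
  \<open>n\<^sup>2 * h\<close>; by the separation the rest of the signal outweighs the noise
  deviation and the threshold together.\<close>

lemma signal_dominates:
  fixes n g h D \<nu>G Q q s1 :: real
  assumes n: "1 \<le> n" and g: "n / 2 \<le> g" "g \<le> n" and h: "0 < h" and s1: "1 \<le> s1"
    and D: "sep_const s1 * h \<le> D"
    and lin: "- (64 * (s1 + (3 + s1)) * (n * h) + 3 / 128 * (n * D)) \<le> \<nu>G"
    and dev: "\<bar>Q - g * q\<bar> \<le> dev_const s1 * (n\<^sup>2 * h)"
  shows "dev_const s1 * (n\<^sup>2 * h) < g\<^sup>2 * D + 2 * g * \<nu>G + Q - g * q"
proof -
  define a where "a = 64 * (s1 + (3 + s1))"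
  define c where "c = dev_const s1"
  have a: "0 \<le> a" and c: "0 \<le> c" using s1 by (simp_all add: a_def c_def dev_const_def)
  have sep: "sep_const s1 = 10 * (a + c)"
    by (simp add: sep_const_def a_def c_def)
  have D0: "0 \<le> D"
  proof -
    have "0 \<le> 10 * (a + c) * h" using h a c by simp
    thus ?thesis using D unfolding sep by linarith
  qed
  define x where "x = n\<^sup>2 * h"
  have x: "0 < x" using n h by (simp add: x_def)
  have 1: "- (2 * (a * (g * (n * h))) + 3 / 64 * (g * D * n)) \<le> 2 * g * \<nu>G"
  proof -
    have "2 * g * - (a * (n * h) + 3 / 128 * (n * D)) \<le> 2 * g * \<nu>G"
      using g n by (intro mult_left_mono lin[folded a_def]) simp
    moreover have "2 * g * - (a * (n * h) + 3 / 128 * (n * D)) = - (2 * (a * (g * (n * h))) + 3 / 64 * (g * D * n))"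
      by (simp add: algebra_simps)
    ultimately show ?thesis by (simp only:)
  qed
  have 2: "a * (g * (n * h)) \<le> a * x"
  proof -
    have "g * (n * h) \<le> n * (n * h)" using g n h by (intro mult_right_mono) auto
    thus ?thesis using a by (intro mult_left_mono) (auto simp: x_def power2_eq_square)
  qed
  have 3: "g * D * n \<le> 2 * (g\<^sup>2 * D)"
  proof -
    have "g * D * n \<le> g * D * (2 * g)" using g n D0 by (intro mult_left_mono) auto
    thus ?thesis by (simp add: power2_eq_square mult_ac)
  qed
  have 4: "n\<^sup>2 * D \<le> 4 * (g\<^sup>2 * D)"
  proof -
    have "(n / 2)\<^sup>2 * D \<le> g\<^sup>2 * D" using g n D0 by (intro mult_right_mono power_mono) auto
    thus ?thesis by (simp add: power_divide)
  qed
  have 5: "10 * (a * x + c * x) \<le> n\<^sup>2 * D"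
    using mult_left_mono[OF D, of "n\<^sup>2"] by (simp add: sep x_def algebra_simps)
  have 6: "0 \<le> a * x" "0 < c * x"
    using a x s1 by (simp_all add: c_def dev_const_def)
  have 7: "- (c * x) \<le> Q - g * q" using dev by (simp add: x_def c_def abs_le_iff)
  \<comment> \<open>Here \<open>A\<close> is at least \<open>5/2 * (a' + c')\<close>, and
    \<open>(1 - 6/64) * 5/2\<close> exceeds \<open>2\<close>, which covers the losses
    \<open>2 * a'\<close> and \<open>c'\<close> and the threshold \<open>c'\<close>.\<close>
  have "c' < A + w + y"
    if "- (2 * u + 3 / 64 * v) \<le> w" "u \<le> a'" "v \<le> 2 * A" "N \<le> 4 * A" "10 * (a' + c') \<le> N"
      "0 \<le> a'" "0 < c'" "- c' \<le> y" for A N u v w y a' c' :: real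
  proof -
    have "10 * a' + 10 * c' \<le> 4 * A" using that by argo
    moreover have "- 2 * a' - 6 / 64 * A \<le> w" using that by argo
    ultimately show ?thesis using that by argo
  qed
  from this[OF 1 2 3 4 5 6 7] show ?thesis by (simp add: c_def x_def)
qed

section \<open>Noise bounds uniform over removed blocks\<close>

context std_normal_array begin

text \<open>All free parameters are fixed here. The level \<open>s\<close> is the bound on the
  logarithm of the number of blocks plus \<open>s1\<close>, so each kind of tail, summed over all
  blocks, costs no more than one tail at level \<open>s1\<close>.\<close>

lemma uniform_block_bounds:
  fixes \<nu> :: "nat \<Rightarrow> real" and k m :: nat and \<epsilon> \<alpha> h :: real
  defines "Q \<equiv> \<lambda>B \<omega>. \<Sum>j\<in>J. (S B j \<omega>)\<^sup>2"
    and "q \<equiv> real (card J)" and "D \<equiv> \<Sum>j\<in>J. (\<nu> j)\<^sup>2"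
    and "n \<equiv> real (card I)" and "L \<equiv> ln (1 / \<epsilon>)" and "s1 \<equiv> ln (20 / \<alpha>)"
  assumes I: "I \<noteq> {}" and k: "1 \<le> k" "card J \<le> 2 * k" and e: "0 \<le> \<epsilon>" "\<epsilon> < 1/4"
    and \<alpha>: "0 < \<alpha>" "\<alpha> < 1/2"
    and h: "sqrt (real k) / n \<le> h" "\<epsilon>\<^sup>2 * L \<le> h" "sqrt (\<epsilon>\<^sup>2 * L * real k / n) \<le> h"
    and m: "m = 2 * nat \<lfloor>\<epsilon> * n\<rfloor>"
  obtains E where "E \<in> events" "emeasure M E \<le> ennreal (2 * \<alpha> / 5)"
    "\<And>\<omega> B. \<omega> \<in> space M - E \<Longrightarrow> B \<subseteq> I \<Longrightarrow> card B \<le> m \<Longrightarrow>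
       \<bar>Q (I - B) \<omega> - (n - real (card B)) * q\<bar> \<le> dev_const s1 * (n\<^sup>2 * h)"
    "\<And>\<omega> B. \<omega> \<in> space M - E \<Longrightarrow> B \<subseteq> I \<Longrightarrow> card B \<le> m \<Longrightarrow>
       - (64 * (s1 + (3 + s1)) * (n * h) + 3 / 128 * (n * D)) \<le> (\<Sum>j\<in>J. \<nu> j * S (I - B) j \<omega>)"
proof -
  have n: "1 \<le> n" using I finI by (simp add: n_def card_gt_0_iff Suc_le_eq)
  have k': "1 \<le> real k" and q: "0 \<le> q" "q \<le> 2 * real k" using k by (simp_all add: q_def)
  have mle: "real m \<le> 2 * (\<epsilon> * n)"
    using e n by (simp add: m of_nat_nat)
  have s1: "1 \<le> s1" unfolding s1_def using \<alpha> by (intro one_le_ln_divide) auto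
  have exp_s1: "exp (- s1) = \<alpha> / 20" using \<alpha> by (simp add: s1_def exp_minus)
  have L: "1 \<le> L" if "0 < \<epsilon>" unfolding L_def using e that by (intro one_le_ln_divide) auto
  have D: "0 \<le> D" by (simp add: D_def sum_nonneg)
  define t1 where "t1 = 1 / (4 * sqrt (real k))"
  define t2 where "t2 = sqrt (\<epsilon> * n * L) / (4 * (sqrt (\<epsilon> * n * L) + sqrt (real k)))"
  define l where "l = sqrt L / (sqrt (n * real k) + \<epsilon> * n * sqrt L)"
  define s where "s = 3 * (\<epsilon> * n) * L + s1"
  define BB where "BB = {B. B \<subseteq> I \<and> B \<noteq> {} \<and> card B \<le> m}"
  have t: "\<bar>t1\<bar> \<le> 1/4" "\<bar>t2\<bar> \<le> 1/4"
  proof -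
    show "\<bar>t1\<bar> \<le> 1/4" using k' by (simp add: t1_def)
    have "0 \<le> sqrt (\<epsilon> * n * L)"
      using e n L by (cases "\<epsilon> = 0") auto
    moreover have "0 < sqrt (real k)" using k' by simp
    moreover have "\<bar>y / (4 * (y + z))\<bar> \<le> 1/4" if "0 \<le> y" "0 < z" for y z :: real
      using that by (simp add: abs_of_nonneg divide_le_eq)
    ultimately show "\<bar>t2\<bar> \<le> 1/4" unfolding t2_def by blast
  qed
  obtain E where E: "E \<in> events"
    "emeasure M E \<le> ennreal (3 * exp (-s1) + real (card BB) * (5 * exp (-s)))"
    "\<And>\<omega>. \<omega> \<in> space M - E \<Longrightarrow> \<bar>t1 * (Q I \<omega> / n - q)\<bar> \<le> 4 * t1\<^sup>2 * q + s1"
    "\<And>\<omega>. \<omega> \<in> space M - E \<Longrightarrow> - (1 / 64 * (\<Sum>j\<in>J. \<nu> j * S I j \<omega>)) \<le> (1 / 64)\<^sup>2 * n / 2 * D + s1"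
    "\<And>\<omega> B. \<omega> \<in> space M - E \<Longrightarrow> B \<in> BB \<Longrightarrow>
       \<bar>t2 * (Q B \<omega> / real (card B) - q)\<bar> \<le> 4 * t2\<^sup>2 * q + s"
    "\<And>\<omega> B. \<omega> \<in> space M - E \<Longrightarrow> B \<in> BB \<Longrightarrow>
       \<bar>l * (\<Sum>j\<in>J. S (I - B) j \<omega> * S B j \<omega>)\<bar> \<le> l\<^sup>2 * real (card B) / 2 * Q (I - B) \<omega> + s"
    "\<And>\<omega> B. \<omega> \<in> space M - E \<Longrightarrow> B \<in> BB \<Longrightarrow>
       1 / (64 * \<epsilon>) * (\<Sum>j\<in>J. \<nu> j * S B j \<omega>) \<le> (1 / (64 * \<epsilon>))\<^sup>2 * real (card B) / 2 * D + s"
    by (rule simultaneous_bounds[OF I t, of s1 m s "1/64" \<nu> l "1 / (64 * \<epsilon>)"])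
      (rule that, simp_all only: Q_def q_def n_def D_def BB_def)
  \<comment> \<open>As \<open>m\<close> is twice an integer part, a nonempty admissible block forces
    \<open>1 \<le> \<epsilon> * n\<close>. At \<open>\<epsilon> = 0\<close>, where
    \<open>1 / (64 * \<epsilon>)\<close> evaluates to \<open>0\<close>, there are no such
    blocks.\<close>
  have BBr: "0 < \<epsilon>" "1 \<le> \<epsilon> * n" "0 < real (card B)" "real (card B) \<le> 2 * (\<epsilon> * n)" if "B \<in> BB" for B
  proof -
    have B: "B \<subseteq> I" "B \<noteq> {}" "card B \<le> m" using that by (auto simp: BB_def)
    hence cB: "0 < card B" using finite_subset[OF B(1) finI] by (simp add: card_gt_0_iff)
    thus "0 < real (card B)" by simp
    have "0 < nat \<lfloor>\<epsilon> * n\<rfloor>" using cB B(3) m by linarith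
    hence "1 \<le> \<lfloor>\<epsilon> * n\<rfloor>" by linarith
    thus en: "1 \<le> \<epsilon> * n" by linarith
    thus "0 < \<epsilon>" using e by (cases "\<epsilon> = 0") auto
    show "real (card B) \<le> 2 * (\<epsilon> * n)" using B(3) mle by linarith
  qed
  \<comment> \<open>Three tails for the full sum and five kinds for the blocks, at
    \<open>\<alpha> / 20\<close> each, add up to \<open>2 * \<alpha> / 5\<close>; the
    \<open>20\<close> in \<open>s1\<close> is chosen for this.\<close>
  have "3 * exp (-s1) + real (card BB) * (5 * exp (-s)) \<le> 2 * \<alpha> / 5"
  proof -
    have "real (card BB) * exp (- s) \<le> \<alpha> / 20"
    proof (cases "BB = {}")
      case False
      then obtain B where "B \<in> BB" by auto
      note r = BBr[OF this]
      have "real (card BB) \<le> real (card {B. B \<subseteq> I \<and> card B \<le> m})"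
        using finI by (intro of_nat_mono card_mono) (auto simp: BB_def)
      also have "\<dots> \<le> exp (3 * (\<epsilon> * n) * L)"
        unfolding n_def L_def
        using card_bounded_subsets_le[OF finI r(1)] L[OF r(1)] e mle by (simp add: n_def L_def)
      finally have "real (card BB) * exp (- s) \<le> exp (3 * (\<epsilon> * n) * L) * exp (- s)"
        by (intro mult_right_mono) auto
      also have "\<dots> = exp (- s1)" by (simp add: s_def exp_add[symmetric])
      finally show ?thesis using exp_s1 by simp
    qed (use \<alpha> in simp)
    thus ?thesis using exp_s1 by simp
  qed
  hence mE: "emeasure M E \<le> ennreal (2 * \<alpha> / 5)"
    using E(2) by (meson ennreal_leI order_trans)
  have nh: "sqrt (real k) \<le> n * h" "n * sqrt (real k) \<le> n\<^sup>2 * h"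
  proof -
    show *: "sqrt (real k) \<le> n * h" using h(1) n by (simp add: field_simps)
    show "n * sqrt (real k) \<le> n\<^sup>2 * h"
      using mult_left_mono[OF *, of n] n by (simp add: power2_eq_square mult.assoc)
  qed
  show thesis
  proof (rule that[OF E(1) mE])
    fix \<omega> B assume w: "\<omega> \<in> space M - E" and B: "B \<subseteq> I" "card B \<le> m"
    have split: "S I j \<omega> = S (I - B) j \<omega> + S B j \<omega>" for j
      unfolding S_def using B finI by (simp add: sum.subset_diff)
    show "\<bar>Q (I - B) \<omega> - (n - real (card B)) * q\<bar> \<le> dev_const s1 * (n\<^sup>2 * h)"
    proof (cases "B = {}")
      case True
      have "\<bar>Q I \<omega> - n * q\<bar> \<le> (2 + 4 * s1) * (n * sqrt (real k))"
        using gram_deviation_bound[OF _ k' q _ E(3)[OF w, unfolded t1_def]] n s1 by simp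
      also have "\<dots> \<le> dev_const s1 * (n * sqrt (real k))"
        using s1 n by (intro mult_right_mono) (simp_all add: dev_const_def)
      also have "\<dots> \<le> dev_const s1 * (n\<^sup>2 * h)"
        using s1 nh by (intro mult_left_mono) (simp_all add: dev_const_def)
      finally show ?thesis using True by simp
    next
      case False
      hence BB: "B \<in> BB" using B by (simp add: BB_def)
      note r = BBr[OF BB]
      have QI: "Q I \<omega> = Q (I - B) \<omega> + 2 * (\<Sum>j\<in>J. S (I - B) j \<omega> * S B j \<omega>) + Q B \<omega>"
        by (simp add: Q_def split power2_sum sum.distrib sum_distrib_left algebra_simps)
      have QG: "Q (I - B) \<omega> \<le> 2 * Q I \<omega> + 2 * Q B \<omega>"
      proof -
        have *: "(S (I - B) j \<omega>)\<^sup>2 \<le> 2 * (S I j \<omega>)\<^sup>2 + 2 * (S B j \<omega>)\<^sup>2" for j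
        proof -
          have "0 \<le> (S (I - B) j \<omega> + 2 * S B j \<omega>)\<^sup>2" by simp
          thus ?thesis by (simp add: split power2_eq_square algebra_simps)
        qed
        have "Q (I - B) \<omega> \<le> (\<Sum>j\<in>J. 2 * (S I j \<omega>)\<^sup>2 + 2 * (S B j \<omega>)\<^sup>2)"
          unfolding Q_def by (intro sum_mono *)
        thus ?thesis by (simp add: Q_def sum.distrib sum_distrib_left)
      qed
      show ?thesis
        by (rule block_removed_deviation_bound[OF n k' q s1 r(1) _ r(2) L[OF r(1)] h r(3,4) s_def
              QI QG E(3)[OF w, unfolded t1_def] t2_def E(5)[OF w BB] l_def E(6)[OF w BB]])
          (use e in simp)
    qed
    show "- (64 * (s1 + (3 + s1)) * (n * h) + 3 / 128 * (n * D)) \<le> (\<Sum>j\<in>J. \<nu> j * S (I - B) j \<omega>)"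
    proof (cases "B = {}")
      case True
      have "1 \<le> sqrt (real k)" using k' by simp
      hence "1 \<le> n * h" using nh by linarith
      hence "64 * s1 \<le> 64 * (s1 + (3 + s1)) * (n * h)"
        using s1 mult_mono[of "64 * s1" "64 * (s1 + (3 + s1))" 1 "n * h"] by simp
      moreover have "- (\<Sum>j\<in>J. \<nu> j * S I j \<omega>) \<le> n * D / 128 + 64 * s1"
        using mult_left_mono[OF E(4)[OF w], of 64] by (simp add: power2_eq_square mult.commute)
      moreover have "0 \<le> n * D" using n D by simp
      ultimately show ?thesis using True by simp
    next
      case False
      hence BB: "B \<in> BB" using B by (simp add: BB_def)
      note r = BBr[OF BB]
      have "(\<Sum>j\<in>J. \<nu> j * S (I - B) j \<omega>) = (\<Sum>j\<in>J. \<nu> j * S I j \<omega>) - (\<Sum>j\<in>J. \<nu> j * S B j \<omega>)"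
        by (simp add: split sum_subtractf[symmetric] algebra_simps)
      thus ?thesis
        using linear_term_bound[OF n k' r(1,2) L[OF r(1)] s1 h(1,2) r(3,4) D s_def E(4)[OF w] E(7)[OF w BB]]
        by simp
    qed
  qed
qed

end

section \<open>Clean and contaminated samples\<close>

text \<open>The clean sample as one product over all pairs \<open>(i, j)\<close>, which makes joint
  independence of the entries immediate; \<open>sample_law\<close> is a product of products.\<close>

definition entry_law :: "nat \<Rightarrow> nat \<Rightarrow> real \<Rightarrow> real Matrix.vec \<Rightarrow> (nat \<times> nat \<Rightarrow> real) measure" where
  "entry_law d N \<sigma> \<mu> =
     (\<Pi>\<^sub>M p\<in>{..<N} \<times> {..<d}. density lborel (\<lambda>t. ennreal (normal_density (vec_index \<mu> (snd p)) \<sigma> t)))"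

lemma indep_vars_PiM_coordinates:
  assumes P: "P \<noteq> {}" and D: "\<And>p. p \<in> P \<Longrightarrow> prob_space (D p)"
  shows "prob_space.indep_vars (PiM P D) D (\<lambda>p w. w p) P"
proof -
  interpret prob_space "PiM P D" by (intro prob_space_PiM D)
  have "distr (PiM P D) (PiM P D) (\<lambda>w. \<lambda>p\<in>P. w p) = distr (PiM P D) (PiM P D) (\<lambda>w. w)"
    by (intro distr_cong) (auto simp: space_PiM PiE_def extensional_restrict)
  also have "\<dots> = PiM P (\<lambda>p. distr (PiM P D) (D p) (\<lambda>w. w p))"
    unfolding distr_id using distr_PiM_component[of P D] D by (intro PiM_cong) auto
  finally show ?thesis
    by (subst indep_vars_iff_distr_eq_PiM'[OF P]) auto
qed

lemma entry_law_std_normal_array: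
  assumes N: "1 \<le> N" and d: "1 \<le> d" and \<sigma>: "0 < \<sigma>" and J: "J \<subseteq> {..<d}"
  shows "std_normal_array (entry_law d N \<sigma> \<mu>) (\<lambda>p w. (w p - vec_index \<mu> (snd p)) / \<sigma>) {..<N} J"
proof -
  let ?D = "\<lambda>p :: nat \<times> nat. density lborel (\<lambda>t. ennreal (normal_density (vec_index \<mu> (snd p)) \<sigma> t))"
  let ?P = "{..<N} \<times> {..<d}"
  have D: "prob_space (?D p)" for p using \<sigma> by (rule prob_space_normal_density)
  interpret W: prob_space "entry_law d N \<sigma> \<mu>"
    unfolding entry_law_def by (intro prob_space_PiM D)
  have "(0, 0) \<in> ?P" using N d by simp
  hence ne: "?P \<noteq> {}" by blast
  have ind: "W.indep_vars ?D (\<lambda>p w. w p) ?P"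
    unfolding entry_law_def by (rule indep_vars_PiM_coordinates[OF ne D])
  have indZ: "W.indep_vars (\<lambda>_. borel) (\<lambda>p w. (w p - vec_index \<mu> (snd p)) / \<sigma>) ?P"
    using W.indep_vars_compose2[OF ind, where N = "\<lambda>_. borel" and Y = "\<lambda>p t. (t - vec_index \<mu> (snd p)) / \<sigma>"]
    by simp
  have dist: "distributed (entry_law d N \<sigma> \<mu>) lborel (\<lambda>w. (w p - vec_index \<mu> (snd p)) / \<sigma>) std_normal_density"
    if "p \<in> ?P" for p
  proof -
    have "distr (entry_law d N \<sigma> \<mu>) lborel (\<lambda>w. w p) = distr (entry_law d N \<sigma> \<mu>) (?D p) (\<lambda>w. w p)"
      by (intro distr_cong) auto
    also have "\<dots> = ?D p"
      unfolding entry_law_def using distr_PiM_component[of ?P ?D p, OF D that] .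
    finally have "distributed (entry_law d N \<sigma> \<mu>) lborel (\<lambda>w. w p) (normal_density (vec_index \<mu> (snd p)) \<sigma>)"
      using that measurable_component_singleton[of p ?P ?D]
      by (auto simp: distributed_def entry_law_def)
    thus ?thesis by (rule W.normal_standard_normal_convert[OF \<sigma>, THEN iffD1])
  qed
  have JP: "{..<N} \<times> J \<subseteq> ?P" using J by auto
  show ?thesis
  proof (intro std_normal_array.intro std_normal_array_axioms.intro W.prob_space_axioms)
    show "finite J" using J finite_subset by blast
    show "W.indep_vars (\<lambda>_. borel) (\<lambda>p w. (w p - vec_index \<mu> (snd p)) / \<sigma>) ({..<N} \<times> J)"
      by (rule W.indep_vars_subset[OF indZ JP])
  qed (use JP dist in auto)
qed

text \<open>Rows are functions of disjoint sets of entries, hence independent, and reindexing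
  \<open>(i, j)\<close> by \<open>j\<close> identifies the law of each row. Tail bounds for the
  array thereby carry over to the sample.\<close>

lemma sample_law_eq_distr:
  assumes N: "1 \<le> N" and d: "1 \<le> d" and \<sigma>: "0 < \<sigma>"
  shows "sample_law d N \<sigma> \<mu> =
    distr (entry_law d N \<sigma> \<mu>) (data_space d N) (\<lambda>w. \<lambda>i\<in>{..<N}. \<lambda>j\<in>{..<d}. w (i, j))"
proof -
  let ?D = "\<lambda>p :: nat \<times> nat. density lborel (\<lambda>t. ennreal (normal_density (vec_index \<mu> (snd p)) \<sigma> t))"
  let ?P = "{..<N} \<times> {..<d}"
  let ?W = "entry_law d N \<sigma> \<mu>"
  let ?R = "PiM {..<d} (\<lambda>_. borel :: real measure)"
  let ?row = "\<lambda>i w. \<lambda>j\<in>{..<d}. w (i, j)"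
  have D: "prob_space (?D p)" for p using \<sigma> by (rule prob_space_normal_density)
  interpret W: prob_space ?W unfolding entry_law_def by (intro prob_space_PiM D)
  have "(0, 0) \<in> ?P" using N d by simp
  hence ne: "?P \<noteq> {}" by blast
  have ind: "W.indep_vars ?D (\<lambda>p w. w p) ?P"
    unfolding entry_law_def by (rule indep_vars_PiM_coordinates[OF ne D])
  have blocks: "W.indep_vars (\<lambda>i. PiM ({i} \<times> {..<d}) ?D) (\<lambda>i w. \<lambda>p\<in>{i} \<times> {..<d}. w p) {..<N}"
    by (intro W.indep_vars_restrict[OF ind]) (auto simp: disjoint_family_on_def)
  have row_meas: "?row i \<in> measurable (PiM ({i} \<times> {..<d}) ?D) ?R" for i
  proof (rule measurable_restrict)
    fix j assume "j \<in> {..<d}"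
    hence "(\<lambda>w. w (i, j)) \<in> measurable (PiM ({i} \<times> {..<d}) ?D) (?D (i, j))"
      by (intro measurable_component_singleton) auto
    thus "(\<lambda>w. w (i, j)) \<in> measurable (PiM ({i} \<times> {..<d}) ?D) borel" by simp
  qed
  have "W.indep_vars (\<lambda>_. ?R) (\<lambda>i w. ?row i (\<lambda>p\<in>{i} \<times> {..<d}. w p)) {..<N}"
    using W.indep_vars_compose2[OF blocks, where N = "\<lambda>_. ?R" and Y = ?row] row_meas by simp
  moreover have "?row i (\<lambda>p\<in>{i} \<times> {..<d}. w p) = ?row i w" for i and w :: "nat \<times> nat \<Rightarrow> real"
    by (auto simp: fun_eq_iff)
  ultimately have rows: "W.indep_vars (\<lambda>_. ?R) ?row {..<N}" by simp
  have "distr ?W (PiM {..<N} (\<lambda>_. ?R)) (\<lambda>w. \<lambda>i\<in>{..<N}. ?row i w) =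
      PiM {..<N} (\<lambda>i. distr ?W ?R (?row i))"
  proof (rule W.indep_vars_iff_distr_eq_PiM'[THEN iffD1, OF _ _ rows])
    show "{..<N} \<noteq> {}" using N by (simp add: lessThan_empty_iff)
    show "?row i \<in> measurable ?W ?R" if "i \<in> {..<N}" for i
      using rows that by (simp add: W.indep_vars_def)
  qed
  also have "\<dots> = PiM {..<N} (\<lambda>i. gaussian d \<mu> \<sigma>)"
  proof (rule PiM_cong)
    fix i assume i: "i \<in> {..<N}"
    have "distr ?W ?R (?row i) = distr ?W (PiM {..<d} (\<lambda>j. ?D (i, j))) (?row i)"
      by (intro distr_cong sets_PiM_cong) auto
    also have "\<dots> = PiM {..<d} (\<lambda>j. ?D (i, j))"
      unfolding entry_law_def using i
      by (intro distr_PiM_reindex D) (auto simp: inj_on_def)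
    finally show "distr ?W ?R (?row i) = gaussian d \<mu> \<sigma>" by (simp add: gaussian_def)
  qed simp
  finally show ?thesis by (simp add: sample_law_def data_space_def)
qed

lemma space_sample_law: "space (sample_law d N \<sigma> \<mu>) = space (data_space d N)"
  by (simp add: sample_law_def data_space_def gaussian_def space_PiM)

lemma sets_sample_law: "sets (sample_law d N \<sigma> \<mu>) = sets (data_space d N)"
  unfolding sample_law_def data_space_def gaussian_def by (intro sets_PiM_cong) auto

section \<open>The energy statistic and the robust test\<close>

definition centred_energy :: "nat set \<Rightarrow> real \<Rightarrow> nat set \<Rightarrow> dataset \<Rightarrow> real" where
  "centred_energy J \<sigma> G x = (\<Sum>j\<in>J. (\<Sum>i\<in>G. x i j)\<^sup>2) - real (card G) * real (card J) * \<sigma>\<^sup>2"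

lemma centred_energy_measurable:
  assumes "J \<subseteq> {..<d}" "G \<subseteq> {..<N}"
  shows "centred_energy J \<sigma> G \<in> borel_measurable (data_space d N)"
proof -
  have "(\<lambda>x. x i j) \<in> borel_measurable (data_space d N)" if "i \<in> G" "j \<in> J" for i j
  proof -
    have "(\<lambda>x. x i) \<in> measurable (data_space d N) (PiM {..<d} (\<lambda>_. borel))"
      unfolding data_space_def using that assms by (intro measurable_component_singleton) auto
    moreover have "(\<lambda>y. y j) \<in> measurable (PiM {..<d} (\<lambda>_. borel :: real measure)) borel"
      using that assms by (intro measurable_component_singleton) auto
    ultimately show ?thesis by (rule measurable_compose)
  qed
  thus ?thesis unfolding centred_energy_def[abs_def]
    by (intro borel_measurable_diff borel_measurable_sum borel_measurable_power) auto
qed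

lemma centred_energy_cong:
  assumes "\<And>i. i \<in> G \<Longrightarrow> x i = y i"
  shows "centred_energy J \<sigma> G x = centred_energy J \<sigma> G y"
  unfolding centred_energy_def using assms by simp

lemma energy_exceedance_sets:
  assumes J: "J \<subseteq> {..<d}" and p: "Measurable.pred borel p"
  shows "{x \<in> space (data_space d N). \<exists>B\<in>Pow {..<N}. card B \<le> m \<and>
      p (centred_energy J \<sigma> ({..<N} - B) x)} \<in> sets (data_space d N)"
proof (rule sets.sets_Collect_finite_Ex)
  fix B assume "B \<in> Pow {..<N}"
  have "{..<N} - B \<subseteq> {..<N}" by auto
  note [measurable] = centred_energy_measurable[OF J this] p
  show "{x \<in> space (data_space d N). card B \<le> m \<and> p (centred_energy J \<sigma> ({..<N} - B) x)}
      \<in> sets (data_space d N)" by measurable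
qed simp

text \<open>The deviation bound for standardised noise from \<open>uniform_block_bounds\<close>,
  rescaled to variance \<open>\<sigma>\<^sup>2\<close>.\<close>

definition threshold :: "real \<Rightarrow> nat \<Rightarrow> real \<Rightarrow> real \<Rightarrow> real" where
  "threshold \<sigma> N h \<alpha> = \<sigma>\<^sup>2 * (dev_const (ln (20 / \<alpha>)) * ((real N)\<^sup>2 * h))"

text \<open>Off the exceptional event of \<open>uniform_block_bounds\<close> both claims are
  deterministic: without signal the deviation bound keeps every energy below the threshold, and with
  enough signal \<open>signal_dominates\<close> lifts every energy above it.\<close>

lemma centred_energy_tails:
  fixes \<mu> :: "real Matrix.vec" and J :: "nat set" and k m N d :: nat and \<epsilon> \<alpha> h \<sigma> :: real
  defines "L \<equiv> ln (1 / \<epsilon>)"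
    and "D \<equiv> (\<Sum>j\<in>J. (vec_index \<mu> j / \<sigma>)\<^sup>2)"
    and "T \<equiv> \<lambda>B. centred_energy J \<sigma> ({..<N} - B)"
  assumes N: "1 \<le> N" and d: "1 \<le> d" and \<sigma>: "0 < \<sigma>" and J: "J \<subseteq> {..<d}"
    and k: "1 \<le> k" "card J \<le> 2 * k" and e: "0 \<le> \<epsilon>" "\<epsilon> < 1/4"
    and \<alpha>: "0 < \<alpha>" "\<alpha> < 1/2"
    and h: "sqrt (real k) / real N \<le> h" "\<epsilon>\<^sup>2 * L \<le> h" "sqrt (\<epsilon>\<^sup>2 * L * real k / real N) \<le> h"
    and m: "m = 2 * nat \<lfloor>\<epsilon> * real N\<rfloor>"
  shows "D = 0 \<Longrightarrow> emeasure (sample_law d N \<sigma> \<mu>) {x \<in> space (data_space d N).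
      \<exists>B\<in>Pow {..<N}. card B \<le> m \<and> threshold \<sigma> N h \<alpha> < T B x} \<le> ennreal (2 * \<alpha> / 5)"
    and "sep_const (ln (20 / \<alpha>)) * h \<le> D \<Longrightarrow> emeasure (sample_law d N \<sigma> \<mu>) {x \<in> space (data_space d N).
      \<exists>B\<in>Pow {..<N}. card B \<le> m \<and> T B x \<le> threshold \<sigma> N h \<alpha>} \<le> ennreal (2 * \<alpha> / 5)"
proof -
  let ?W = "entry_law d N \<sigma> \<mu>"
  let ?c = "\<lambda>w. \<lambda>i\<in>{..<N}. \<lambda>j\<in>{..<d}. w (i, j)"
  define s1 where "s1 = ln (20 / \<alpha>)"
  define n where "n = real N"
  interpret std_normal_array ?W "\<lambda>p w. (w p - vec_index \<mu> (snd p)) / \<sigma>" "{..<N}" J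
    by (rule entry_law_std_normal_array[OF N d \<sigma> J])
  have s1: "1 \<le> s1" unfolding s1_def using \<alpha> by (intro one_le_ln_divide) auto
  have n: "1 \<le> n" using N by (simp add: n_def)
  have h0: "0 < h"
  proof -
    have "0 < sqrt (real k) / real N" using k N by simp
    thus ?thesis using h(1) by linarith
  qed
  have ne: "{..<N} \<noteq> {}" using N by (simp add: lessThan_empty_iff)
  define Q where "Q B w = (\<Sum>j\<in>J. (S B j w)\<^sup>2)" for B w
  define lin where "lin B w = (\<Sum>j\<in>J. vec_index \<mu> j / \<sigma> * S B j w)" for B w
  obtain E where E: "E \<in> events" "emeasure ?W E \<le> ennreal (2 * \<alpha> / 5)"
    and dev: "\<And>w B. w \<in> space ?W - E \<Longrightarrow> B \<subseteq> {..<N} \<Longrightarrow> card B \<le> m \<Longrightarrow>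
       \<bar>Q ({..<N} - B) w - (n - real (card B)) * real (card J)\<bar> \<le> dev_const s1 * (n\<^sup>2 * h)"
    and lin: "\<And>w B. w \<in> space ?W - E \<Longrightarrow> B \<subseteq> {..<N} \<Longrightarrow> card B \<le> m \<Longrightarrow>
       - (64 * (s1 + (3 + s1)) * (n * h) + 3 / 128 * (n * D)) \<le> lin ({..<N} - B) w"
    by (rule uniform_block_bounds[where \<nu> = "\<lambda>j. vec_index \<mu> j / \<sigma>" and k = k and m = m and \<epsilon> = \<epsilon>
          and \<alpha> = \<alpha> and h = h, OF ne k e \<alpha>])
      (use h m in \<open>simp_all add: Q_def lin_def D_def L_def s1_def n_def\<close>)
  \<comment> \<open>A coordinate of a data sum is \<open>\<sigma>\<close> times the noise sum plus
    one standardised mean per sample; its square splits into signal, linear and noise parts.\<close>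
  have energy: "T B (?c w) = \<sigma>\<^sup>2 * ((n - real (card B))\<^sup>2 * D + 2 * (n - real (card B)) * lin ({..<N} - B) w
      + Q ({..<N} - B) w - (n - real (card B)) * real (card J))"
    if B: "B \<subseteq> {..<N}" for B w
  proof -
    let ?G = "{..<N} - B"
    have g: "real (card ?G) = n - real (card B)"
      using B card_mono[OF _ B] by (simp add: card_Diff_subset finite_subset n_def of_nat_diff)
    have row: "(\<Sum>i\<in>?G. ?c w i j) = \<sigma> * (S ?G j w + real (card ?G) * (vec_index \<mu> j / \<sigma>))" if "j \<in> J" for j
    proof -
      have "(\<Sum>i\<in>?G. ?c w i j) = (\<Sum>i\<in>?G. \<sigma> * ((w (i, j) - vec_index \<mu> j) / \<sigma>) + vec_index \<mu> j)"
        using that J \<sigma> by (intro sum.cong) auto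
      also have "\<dots> = \<sigma> * S ?G j w + real (card ?G) * vec_index \<mu> j"
        by (simp only: S_def snd_conv sum.distrib sum_distrib_left sum_constant)
      also have "\<dots> = \<sigma> * (S ?G j w + real (card ?G) * (vec_index \<mu> j / \<sigma>))"
        using \<sigma> by (simp add: distrib_left)
      finally show ?thesis .
    qed
    have sq: "(\<sigma> * (s + g * v))\<^sup>2 = \<sigma>\<^sup>2 * (g\<^sup>2 * v\<^sup>2 + 2 * g * (v * s) + s\<^sup>2)" for s g v
      by (simp add: power2_eq_square algebra_simps)
    have "(\<Sum>j\<in>J. (\<Sum>i\<in>?G. ?c w i j)\<^sup>2) =
        (\<Sum>j\<in>J. \<sigma>\<^sup>2 * ((real (card ?G))\<^sup>2 * (vec_index \<mu> j / \<sigma>)\<^sup>2 +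
          2 * real (card ?G) * (vec_index \<mu> j / \<sigma> * S ?G j w) + (S ?G j w)\<^sup>2))"
      by (intro sum.cong refl) (simp only: row sq)
    also have "\<dots> = \<sigma>\<^sup>2 * ((real (card ?G))\<^sup>2 * D + 2 * real (card ?G) * lin ?G w + Q ?G w)"
      unfolding D_def lin_def Q_def by (simp only: sum.distrib sum_distrib_left[symmetric])
    finally show ?thesis
      unfolding T_def centred_energy_def g by (simp add: algebra_simps)
  qed
  \<comment> \<open>The bound \<open>1/4\<close> on \<open>\<epsilon>\<close> ensures that at least
    half of the samples remain, as \<open>signal_dominates\<close> requires, although up to
    \<open>2 * \<epsilon> * N\<close> may be removed.\<close>
  have cardB: "real (card B) \<le> n / 2" if "B \<subseteq> {..<N}" "card B \<le> m" for B
  proof -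
    have "real m \<le> 2 * (\<epsilon> * n)" using e n by (simp add: m n_def of_nat_nat)
    also have "\<dots> \<le> 2 * (1/4 * n)" using e n by (intro mult_left_mono mult_right_mono) auto
    finally show ?thesis using that by simp
  qed
  have c_meas: "?c \<in> measurable ?W (data_space d N)"
    unfolding data_space_def
  proof (intro measurable_restrict)
    fix i j assume "i \<in> {..<N}" "j \<in> {..<d}"
    hence "(\<lambda>w. w (i, j)) \<in> measurable ?W (density lborel (\<lambda>t. ennreal (normal_density (vec_index \<mu> j) \<sigma> t)))"
      unfolding entry_law_def
      using measurable_component_singleton[of "(i, j)" "{..<N} \<times> {..<d}"] by fastforce
    thus "(\<lambda>w. w (i, j)) \<in> borel_measurable ?W" by simp
  qed
  have transfer: "emeasure (sample_law d N \<sigma> \<mu>) {x \<in> space (data_space d N). \<exists>B\<in>Pow {..<N}. card B \<le> m \<and> p (T B x)}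
      \<le> ennreal (2 * \<alpha> / 5)"
    if p: "Measurable.pred borel p"
      and np: "\<And>w B. w \<in> space ?W - E \<Longrightarrow> B \<subseteq> {..<N} \<Longrightarrow> card B \<le> m \<Longrightarrow> \<not> p (T B (?c w))" for p
  proof -
    let ?A = "{x \<in> space (data_space d N). \<exists>B\<in>Pow {..<N}. card B \<le> m \<and> p (T B x)}"
    have A: "?A \<in> sets (data_space d N)"
      unfolding T_def by (rule energy_exceedance_sets[OF J p])
    have sub: "?c -` ?A \<inter> space ?W \<subseteq> E"
    proof (rule subsetI, rule ccontr)
      fix w assume w: "w \<in> ?c -` ?A \<inter> space ?W" "w \<notin> E"
      then obtain B where "B \<subseteq> {..<N}" "card B \<le> m" "p (T B (?c w))" by blast
      thus False using np[of w B] w by blast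
    qed
    have "emeasure (sample_law d N \<sigma> \<mu>) ?A = emeasure ?W (?c -` ?A \<inter> space ?W)"
      unfolding sample_law_eq_distr[OF N d \<sigma>] by (rule emeasure_distr[OF c_meas A])
    also have "\<dots> \<le> emeasure ?W E"
      by (intro emeasure_mono E(1) sub)
    finally show ?thesis using E(2) by (rule order_trans)
  qed
  {
    assume D0: "D = 0"
    have "\<not> threshold \<sigma> N h \<alpha> < T B (?c w)"
      if w: "w \<in> space ?W - E" and B: "B \<subseteq> {..<N}" "card B \<le> m" for w B
    proof -
      have "finite J" using J finite_subset by blast
      hence z: "vec_index \<mu> j / \<sigma> = 0" if "j \<in> J" for j
        using D0 that sum_nonneg_eq_0_iff[of J "\<lambda>j. (vec_index \<mu> j / \<sigma>)\<^sup>2"]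
        unfolding D_def by auto
      have "lin ({..<N} - B) w = 0"
        unfolding lin_def by (intro sum.neutral ballI) (simp only: z mult_zero_left)
      moreover have "Q ({..<N} - B) w - (n - real (card B)) * real (card J) \<le> dev_const s1 * (n\<^sup>2 * h)"
        using dev[OF w B] by linarith
      ultimately show ?thesis
        unfolding energy[OF B(1)] threshold_def
        using \<sigma> D0 by (simp add: s1_def n_def not_less mult_left_mono)
    qed
    from transfer[of "\<lambda>t. threshold \<sigma> N h \<alpha> < t", OF _ this]
    show "emeasure (sample_law d N \<sigma> \<mu>) {x \<in> space (data_space d N).
      \<exists>B\<in>Pow {..<N}. card B \<le> m \<and> threshold \<sigma> N h \<alpha> < T B x} \<le> ennreal (2 * \<alpha> / 5)" by simp
  next
    assume sep: "sep_const (ln (20 / \<alpha>)) * h \<le> D"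
    have "\<not> T B (?c w) \<le> threshold \<sigma> N h \<alpha>"
      if w: "w \<in> space ?W - E" and B: "B \<subseteq> {..<N}" "card B \<le> m" for w B
    proof -
      have "dev_const s1 * (n\<^sup>2 * h) < (n - real (card B))\<^sup>2 * D + 2 * (n - real (card B)) * lin ({..<N} - B) w
          + Q ({..<N} - B) w - (n - real (card B)) * real (card J)"
        using cardB[OF B]
        by (intro signal_dominates[OF n _ _ h0 s1 sep[folded s1_def] lin[OF w B] dev[OF w B]]) auto
      thus ?thesis
        unfolding energy[OF B(1)] threshold_def not_le
        using \<sigma> by (simp add: s1_def n_def)
    qed
    from transfer[of "\<lambda>t. t \<le> threshold \<sigma> N h \<alpha>", OF _ this]
    show "emeasure (sample_law d N \<sigma> \<mu>) {x \<in> space (data_space d N).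
      \<exists>B\<in>Pow {..<N}. card B \<le> m \<and> T B x \<le> threshold \<sigma> N h \<alpha>} \<le> ennreal (2 * \<alpha> / 5)" by simp
  }
qed

text \<open>Subsets \<open>G\<close> of \<open>S\<close> have to be tested because under the alternative only the uncorrupted
  part of \<open>S\<close> can be controlled.\<close>

definition robust_test :: "nat \<Rightarrow> nat \<Rightarrow> nat set \<Rightarrow> real \<Rightarrow> real \<Rightarrow> dataset \<Rightarrow> nat" where
  "robust_test N m J \<sigma> \<tau> x =
     (if \<exists>S\<in>Pow {..<N}. N \<le> card S + m \<and>
           (\<forall>G\<in>Pow S. N \<le> card G + 2 * m \<longrightarrow> centred_energy J \<sigma> G x \<le> \<tau>) then 0 else 1)"

lemma robust_test_in_tests:
  assumes "J \<subseteq> {..<d}"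
  shows "robust_test N m J \<sigma> \<tau> \<in> tests d N"
proof -
  have "{x \<in> space (data_space d N). \<exists>S\<in>Pow {..<N}. N \<le> card S + m \<and>
           (\<forall>G\<in>Pow S. N \<le> card G + 2 * m \<longrightarrow> centred_energy J \<sigma> G x \<le> \<tau>)} \<in> sets (data_space d N)"
  proof (intro sets.sets_Collect_finite_Ex sets.sets_Collect_conj sets.sets_Collect_finite_All' sets.sets_Collect_imp)
    fix S G assume "S \<in> Pow {..<N}" "G \<in> Pow S"
    hence "G \<subseteq> {..<N}" by auto
    note [measurable] = centred_energy_measurable[OF assms this]
    show "{x \<in> space (data_space d N). centred_energy J \<sigma> G x \<le> \<tau>} \<in> sets (data_space d N)"
      by measurable
  qed (auto intro: finite_subset)
  thus ?thesis
    unfolding tests_def robust_test_def[abs_def] by (rule measurable_If[rotated 2]) simp_all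
qed

lemma uncorrupted:
  assumes C: "\<C> \<in> adversaries d N \<epsilon>" and x: "x \<in> space (data_space d N)"
  defines "U \<equiv> {i\<in>{..<N}. \<C> x i = x i}"
  shows "U \<subseteq> {..<N}" "N \<le> card U + nat \<lfloor>\<epsilon> * real N\<rfloor>"
proof -
  show "U \<subseteq> {..<N}" by (auto simp: U_def)
  have "real (card {i\<in>{..<N}. \<C> x i \<noteq> x i}) \<le> \<epsilon> * real N" using C x by (auto simp: adversaries_def)
  hence "card {i\<in>{..<N}. \<C> x i \<noteq> x i} \<le> nat \<lfloor>\<epsilon> * real N\<rfloor>" by (rule le_nat_floor)
  moreover have "card U + card {i\<in>{..<N}. \<C> x i \<noteq> x i} = N"
  proof -
    have "U \<union> {i\<in>{..<N}. \<C> x i \<noteq> x i} = {..<N}" by (auto simp: U_def)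
    moreover have "card (U \<union> {i\<in>{..<N}. \<C> x i \<noteq> x i}) = card U + card {i\<in>{..<N}. \<C> x i \<noteq> x i}"
      by (rule card_Un_disjoint) (auto simp: U_def)
    ultimately show ?thesis by simp
  qed
  ultimately show "N \<le> card U + nat \<lfloor>\<epsilon> * real N\<rfloor>" by linarith
qed

text \<open>The error event of an arbitrary adversary need not be measurable; it is controlled
  through a measurable event on the clean sample that contains it.\<close>

lemma err_prob_le:
  assumes "A \<in> sets (data_space d N)"
    and "\<And>x. x \<in> space (data_space d N) \<Longrightarrow> \<phi> (\<C> x) = b \<Longrightarrow> x \<in> A"
    and "emeasure (sample_law d N \<sigma> \<mu>) A \<le> p"
  shows "err_prob d N \<sigma> \<mu> \<C> \<phi> b \<le> p"
proof -
  have "err_prob d N \<sigma> \<mu> \<C> \<phi> b \<le> outer_measure_of (sample_law d N \<sigma> \<mu>) A"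
    unfolding err_prob_def space_sample_law using assms(2) by (intro outer_measure_of_mono) auto
  also have "\<dots> = emeasure (sample_law d N \<sigma> \<mu>) A"
    using assms(1) by (intro outer_measure_of_eq) (simp add: sets_sample_law)
  finally show ?thesis using assms(3) by (rule order_trans)
qed

text \<open>Any error exhibits a set of uncorrupted samples, missing at most
  \<open>2 * nat \<lfloor>\<epsilon> * real N\<rfloor>\<close> indices, whose energy is atypical. On
  such a set observed and clean energies agree, so a single event on the clean sample covers all
  adversaries.\<close>

lemma robust_test_errors:
  fixes k N d :: nat and \<epsilon> \<alpha> h \<sigma> \<rho> :: real
  assumes N: "1 \<le> N" and d: "1 \<le> d" and \<sigma>: "0 < \<sigma>" and J: "J \<subseteq> {..<d}"
    and k: "1 \<le> k" "card J \<le> 2 * k" and e: "0 \<le> \<epsilon>" "\<epsilon> < 1/4"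
    and \<alpha>: "0 < \<alpha>" "\<alpha> < 1/2"
    and h: "sqrt (real k) / real N \<le> h" "\<epsilon>\<^sup>2 * ln (1 / \<epsilon>) \<le> h"
      "sqrt (\<epsilon>\<^sup>2 * ln (1 / \<epsilon>) * real k / real N) \<le> h"
    and sep: "\<And>\<mu>. \<mu> \<in> K \<Longrightarrow> \<rho> \<le> vnorm \<mu> \<Longrightarrow>
      sep_const (ln (20 / \<alpha>)) * h \<le> (\<Sum>j\<in>J. (vec_index \<mu> j / \<sigma>)\<^sup>2)"
  defines "\<phi> \<equiv> robust_test N (nat \<lfloor>\<epsilon> * real N\<rfloor>) J \<sigma> (threshold \<sigma> N h \<alpha>)"
  shows "type_I_error d N \<sigma> \<epsilon> \<phi> < ennreal \<alpha>" "type_II_error d K N \<sigma> \<epsilon> \<rho> \<phi> < ennreal \<alpha>"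
proof -
  let ?m = "nat \<lfloor>\<epsilon> * real N\<rfloor>"
  let ?T = "\<lambda>B. centred_energy J \<sigma> ({..<N} - B)"
  define \<tau> where "\<tau> = threshold \<sigma> N h \<alpha>"
  have \<alpha>': "ennreal (2 * \<alpha> / 5) < ennreal \<alpha>" using \<alpha> by (simp add: ennreal_less_iff)
  have "type_I_error d N \<sigma> \<epsilon> \<phi> \<le> ennreal (2 * \<alpha> / 5)"
    unfolding type_I_error_def
  proof (intro SUP_least)
    fix \<C> assume C: "\<C> \<in> adversaries d N \<epsilon>"
    show "err_prob d N \<sigma> (0\<^sub>v d) \<C> \<phi> 1 \<le> ennreal (2 * \<alpha> / 5)"
    proof (rule err_prob_le)
      let ?A = "{x \<in> space (data_space d N). \<exists>B\<in>Pow {..<N}. card B \<le> 2 * ?m \<and> \<tau> < ?T B x}"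
      show "?A \<in> sets (data_space d N)"
        by (rule energy_exceedance_sets[OF J, of "\<lambda>t. \<tau> < t"]) simp
      have "(\<Sum>j\<in>J. (vec_index (0\<^sub>v d) j / \<sigma>)\<^sup>2) = 0"
        using J by (intro sum.neutral) auto
      thus "emeasure (sample_law d N \<sigma> (0\<^sub>v d)) ?A \<le> ennreal (2 * \<alpha> / 5)"
        unfolding \<tau>_def by (rule centred_energy_tails(1)[OF N d \<sigma> J k e \<alpha> h refl])
      fix x assume x: "x \<in> space (data_space d N)" and one: "\<phi> (\<C> x) = 1"
      note U = uncorrupted[OF C x]
      let ?U = "{i\<in>{..<N}. \<C> x i = x i}"
      \<comment> \<open>The uncorrupted set is large enough to be a candidate for \<open>S\<close>,
        so rejection yields a violating subset of it.\<close>
      have "\<not> (\<forall>G\<in>Pow ?U. N \<le> card G + 2 * ?m \<longrightarrow> centred_energy J \<sigma> G (\<C> x) \<le> \<tau>)"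
        using one U unfolding \<phi>_def robust_test_def \<tau>_def by (auto split: if_splits)
      then obtain G where G: "G \<subseteq> ?U" "N \<le> card G + 2 * ?m" "\<tau> < centred_energy J \<sigma> G (\<C> x)"
        by (auto simp: not_le)
      have "centred_energy J \<sigma> G (\<C> x) = centred_energy J \<sigma> G x"
        using G(1) by (intro centred_energy_cong) auto
      moreover have GN: "G \<subseteq> {..<N}" using G(1) by auto
      hence "{..<N} - ({..<N} - G) = G" by auto
      moreover have "card ({..<N} - G) \<le> 2 * ?m"
        using G(2) GN by (simp add: card_Diff_subset finite_subset)
      ultimately have "{..<N} - G \<in> Pow {..<N} \<and> card ({..<N} - G) \<le> 2 * ?m \<and> \<tau> < ?T ({..<N} - G) x"
        using G(3) by auto
      thus "x \<in> ?A" using x by blast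
    qed
  qed
  thus "type_I_error d N \<sigma> \<epsilon> \<phi> < ennreal \<alpha>" using \<alpha>' by (rule order.strict_trans1)
  have "type_II_error d K N \<sigma> \<epsilon> \<rho> \<phi> \<le> ennreal (2 * \<alpha> / 5)"
    unfolding type_II_error_def
  proof (intro SUP_least)
    fix \<mu> \<C> assume mu: "\<mu> \<in> {\<mu> \<in> K. \<rho> \<le> vnorm \<mu>}" and C: "\<C> \<in> adversaries d N \<epsilon>"
    show "err_prob d N \<sigma> \<mu> \<C> \<phi> 0 \<le> ennreal (2 * \<alpha> / 5)"
    proof (rule err_prob_le)
      let ?A = "{x \<in> space (data_space d N). \<exists>B\<in>Pow {..<N}. card B \<le> 2 * ?m \<and> ?T B x \<le> \<tau>}"
      show "?A \<in> sets (data_space d N)"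
        by (rule energy_exceedance_sets[OF J, of "\<lambda>t. t \<le> \<tau>"]) simp
      have "sep_const (ln (20 / \<alpha>)) * h \<le> (\<Sum>j\<in>J. (vec_index \<mu> j / \<sigma>)\<^sup>2)"
        using sep mu by auto
      thus "emeasure (sample_law d N \<sigma> \<mu>) ?A \<le> ennreal (2 * \<alpha> / 5)"
        unfolding \<tau>_def by (rule centred_energy_tails(2)[OF N d \<sigma> J k e \<alpha> h refl])
      fix x assume x: "x \<in> space (data_space d N)" and zero: "\<phi> (\<C> x) = 0"
      note U = uncorrupted[OF C x]
      let ?U = "{i\<in>{..<N}. \<C> x i = x i}"
      obtain S where S: "S \<subseteq> {..<N}" "N \<le> card S + ?m"
        "\<And>G. G \<subseteq> S \<Longrightarrow> N \<le> card G + 2 * ?m \<Longrightarrow> centred_energy J \<sigma> G (\<C> x) \<le> \<tau>"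
        using zero unfolding \<phi>_def robust_test_def \<tau>_def by (auto split: if_splits)
      \<comment> \<open>Two sets that each miss at most \<open>?m\<close> indices have an
        intersection missing at most \<open>2 * ?m\<close>, which is the size down to which the test
        examines subsets.\<close>
      let ?G = "S \<inter> ?U"
      have fin: "finite S" "finite ?U" using S(1) U(1) by (auto intro: finite_subset)
      have "card S + card ?U = card (S \<union> ?U) + card ?G" by (rule card_Un_Int[OF fin])
      moreover have "card (S \<union> ?U) \<le> card {..<N}" using S(1) U(1) by (intro card_mono) auto
      ultimately have cG: "N \<le> card ?G + 2 * ?m" using S(2) U(2) by simp
      have "centred_energy J \<sigma> ?G (\<C> x) = centred_energy J \<sigma> ?G x"
        by (intro centred_energy_cong) auto
      hence le: "centred_energy J \<sigma> ?G x \<le> \<tau>" using S(3)[of ?G] cG by simp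
      have GN: "?G \<subseteq> {..<N}" using S(1) by auto
      hence "{..<N} - ({..<N} - ?G) = ?G" by auto
      moreover have "card ({..<N} - ?G) \<le> 2 * ?m"
        using cG GN card_Diff_subset[of ?G "{..<N}"] fin by simp
      ultimately have "{..<N} - ?G \<in> Pow {..<N} \<and> card ({..<N} - ?G) \<le> 2 * ?m \<and> ?T ({..<N} - ?G) x \<le> \<tau>"
        using le by auto
      thus "x \<in> ?A" using x by blast
    qed
  qed
  thus "type_II_error d K N \<sigma> \<epsilon> \<rho> \<phi> < ennreal \<alpha>" using \<alpha>' by (rule order.strict_trans1)
qed

section \<open>From the Kolmogorov width to the critical radius\<close>

lemma vnorm_nonneg: "0 \<le> vnorm v"
  by (simp add: vnorm_def scalar_prod_def sum_nonneg)

lemma vnorm_square: "(vnorm v)\<^sup>2 = (\<Sum>j<dim_vec v. (vec_index v j)\<^sup>2)"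
  by (simp add: vnorm_def scalar_prod_def sum_nonneg power2_eq_square lessThan_atLeast0)

lemma sep_const_pos:
  assumes "0 < \<alpha>" "\<alpha> < 1/2"
  shows "0 < sep_const (ln (20 / \<alpha>))"
proof -
  have "0 \<le> ln (20 / \<alpha>)" using assms by simp
  thus ?thesis by (simp add: sep_const_def dev_const_def)
qed

text \<open>The extra \<open>4\<close> in the constant pays for the energy off \<open>J\<close>: a
  factor \<open>2\<close> for squaring the width plus a slack, and a factor \<open>2\<close> for
  rounding the projection. At least \<open>sep_const (ln (20 / \<alpha>))\<close> times
  \<open>\<sigma>\<^sup>2 * h\<close> then remains on \<open>J\<close>.\<close>

lemma exists_good_test:
  fixes k N d :: nat and \<epsilon> \<alpha> \<sigma> \<rho> :: real
  assumes K: "QCO d K" and N: "1 \<le> N" and \<sigma>: "0 < \<sigma>" and k: "k \<in> {1..d}"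
    and e: "0 \<le> \<epsilon>" "\<epsilon> < 1/4" and \<alpha>: "0 < \<alpha>" "\<alpha> < 1/2" and \<rho>: "0 < \<rho>"
    and large: "ennreal (sep_const (ln (20 / \<alpha>)) + 4) * E_raw_sq d K N \<sigma> \<epsilon> k \<le> ennreal (\<rho>\<^sup>2)"
  shows "\<exists>\<phi>\<in>tests d N. type_I_error d N \<sigma> \<epsilon> \<phi> < ennreal \<alpha> \<and> type_II_error d K N \<sigma> \<epsilon> \<rho> \<phi> < ennreal \<alpha>"
proof -
  define c where "c = sep_const (ln (20 / \<alpha>))"
  define h where "h = Max {sqrt (real k) / real N, \<epsilon>\<^sup>2 * ln (1 / \<epsilon>), sqrt (\<epsilon>\<^sup>2 * ln (1 / \<epsilon>) * real k / real N)}"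
  have c: "0 < c" unfolding c_def by (rule sep_const_pos[OF \<alpha>])
  have h: "sqrt (real k) / real N \<le> h" "\<epsilon>\<^sup>2 * ln (1 / \<epsilon>) \<le> h"
    "sqrt (\<epsilon>\<^sup>2 * ln (1 / \<epsilon>) * real k / real N) \<le> h"
    unfolding h_def by (auto intro!: Max_ge)
  have h0: "0 < h"
  proof -
    have "0 < sqrt (real k) / real N" using k N by simp
    thus ?thesis using h(1) by linarith
  qed
  have E: "E_raw_sq d K N \<sigma> \<epsilon> k = (kolmogorov_width d K k)\<^sup>2 + ennreal (\<sigma>\<^sup>2 * h)"
    by (simp add: E_raw_sq_def h_def)
  \<comment> \<open>An infinite width would make the lower bound on \<open>\<rho>\<^sup>2\<close>
    infinite.\<close>
  have fin: "kolmogorov_width d K k \<noteq> \<top>"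
  proof
    assume "kolmogorov_width d K k = \<top>"
    hence "E_raw_sq d K N \<sigma> \<epsilon> k = \<top>" by (simp add: E)
    hence "ennreal (c + 4) * \<top> \<le> ennreal (\<rho>\<^sup>2)" using large by (simp add: c_def)
    thus False using c by (simp add: ennreal_mult_top top_unique)
  qed
  define w where "w = enn2real (kolmogorov_width d K k)"
  have w: "0 \<le> w" "kolmogorov_width d K k = ennreal w"
    using fin by (simp_all add: w_def less_top)
  have "ennreal ((c + 4) * (w\<^sup>2 + \<sigma>\<^sup>2 * h)) \<le> ennreal (\<rho>\<^sup>2)"
    using large c w h0 by (simp add: E ennreal_mult ennreal_plus ennreal_power c_def)
  hence \<rho>2: "(c + 4) * (w\<^sup>2 + \<sigma>\<^sup>2 * h) \<le> \<rho>\<^sup>2" by (simp add: ennreal_le_iff)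
  \<comment> \<open>The infimum over projections need not be attained. The slack has square
    \<open>\<sigma>\<^sup>2 * h\<close>, so the second summand of \<open>E_raw_sq\<close> absorbs
    it.\<close>
  define \<delta> where "\<delta> = \<sigma> * sqrt h"
  have \<delta>: "0 < \<delta>" "\<delta>\<^sup>2 = \<sigma>\<^sup>2 * h" using \<sigma> h0 by (simp_all add: \<delta>_def power_mult_distrib)
  have "kolmogorov_width d K k < ennreal (w + \<delta>)"
    using w \<delta> by (simp add: ennreal_less_iff)
  then obtain P where P: "P \<in> orth_projections d k" "(SUP \<theta>\<in>K. ennreal (vnorm (\<theta> - P *\<^sub>v \<theta>))) < ennreal (w + \<delta>)"
    unfolding kolmogorov_width_def INF_less_iff by blast
  have W: "(vnorm (\<theta> - P *\<^sub>v \<theta>))\<^sup>2 \<le> 2 * (w\<^sup>2 + \<sigma>\<^sup>2 * h)" if "\<theta> \<in> K" for \<theta>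
  proof -
    have "ennreal (vnorm (\<theta> - P *\<^sub>v \<theta>)) \<le> (SUP \<theta>\<in>K. ennreal (vnorm (\<theta> - P *\<^sub>v \<theta>)))"
      using that by (rule SUP_upper)
    also note P(2)
    finally have "vnorm (\<theta> - P *\<^sub>v \<theta>) \<le> w + \<delta>"
      using w \<delta> by (simp add: ennreal_less_iff vnorm_nonneg del: ennreal_plus)
    hence "(vnorm (\<theta> - P *\<^sub>v \<theta>))\<^sup>2 \<le> (w + \<delta>)\<^sup>2"
      by (intro power_mono vnorm_nonneg)
    also have "\<dots> \<le> 2 * (w\<^sup>2 + \<delta>\<^sup>2)"
      using sum_squares_bound[of w \<delta>] by (simp add: power2_sum)
    finally show ?thesis by (simp add: \<delta>)
  qed
  have Kc: "K \<subseteq> carrier_vec d" and sym: "\<And>\<theta> \<eta>. \<theta> \<in> K \<Longrightarrow> \<forall>j<d. \<eta> j \<in> {-1,1::real} \<Longrightarrow>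
      Matrix.vec d (\<lambda>j. \<eta> j * vec_index \<theta> j) \<in> K"
    using K unfolding QCO_def by auto
  obtain J where J: "J \<subseteq> {..<d}" "card J \<le> 2 * k"
    "\<And>\<theta>. \<theta> \<in> K \<Longrightarrow> (\<Sum>j\<in>{..<d} - J. (vec_index \<theta> j)\<^sup>2) \<le> 2 * (2 * (w\<^sup>2 + \<sigma>\<^sup>2 * h))"
    using coordinate_projection[OF P(1) sym W] by blast
  have sep: "c * h \<le> (\<Sum>j\<in>J. (vec_index \<mu> j / \<sigma>)\<^sup>2)" if \<mu>: "\<mu> \<in> K" "\<rho> \<le> vnorm \<mu>" for \<mu>
  proof -
    have "\<rho>\<^sup>2 \<le> (vnorm \<mu>)\<^sup>2" using \<mu>(2) \<rho> by (intro power_mono) auto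
    also have "\<dots> = (\<Sum>j<d. (vec_index \<mu> j)\<^sup>2)"
      using \<mu>(1) Kc by (auto simp: vnorm_square)
    also have "\<dots> = (\<Sum>j\<in>{..<d} - J. (vec_index \<mu> j)\<^sup>2) + (\<Sum>j\<in>J. (vec_index \<mu> j)\<^sup>2)"
      using J(1) by (intro sum.subset_diff) auto
    finally have "\<rho>\<^sup>2 - 4 * (w\<^sup>2 + \<sigma>\<^sup>2 * h) \<le> (\<Sum>j\<in>J. (vec_index \<mu> j)\<^sup>2)"
      using J(3)[OF \<mu>(1)] by linarith
    moreover have "\<sigma>\<^sup>2 * (c * h) \<le> (c + 4) * (w\<^sup>2 + \<sigma>\<^sup>2 * h) - 4 * (w\<^sup>2 + \<sigma>\<^sup>2 * h)"
      using c by (simp add: algebra_simps)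
    ultimately have "\<sigma>\<^sup>2 * (c * h) \<le> (\<Sum>j\<in>J. (vec_index \<mu> j)\<^sup>2)" using \<rho>2 by linarith
    thus ?thesis using \<sigma> by (simp add: power_divide sum_divide_distrib[symmetric] field_simps)
  qed
  have kd: "1 \<le> k" "1 \<le> d" using k by auto
  note errors = robust_test_errors[OF N kd(2) \<sigma> J(1) kd(1) J(2) e \<alpha> h sep[unfolded c_def]]
  show ?thesis
    by (intro bexI[OF _ robust_test_in_tests[OF J(1)]] conjI) (rule errors; assumption)+
qed

theorem theorem3p8:
  "\<exists>c0::real. 0 < c0 \<and> c0 < 1/2 \<and>
    (\<forall>\<alpha>::real. 0 < \<alpha> \<and> \<alpha> < 1/2 \<longrightarrow>
      (\<exists>C::real. 0 < C \<and>
        (\<forall>(d::nat) (K::real Matrix.vec set) (N::nat) (\<sigma>::real) (\<epsilon>::real).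
          QCO d K \<and> 1 \<le> N \<and> 0 < \<sigma> \<and> 0 \<le> \<epsilon> \<and> \<epsilon> < c0 \<and>
          (SUP \<theta>\<in>K. ennreal (vnorm \<theta>)) > ennreal (\<sigma> / sqrt (real N)) \<longrightarrow>
            (\<forall>k\<in>{1..d}. \<forall>\<rho>::real.
               0 < \<rho> \<and> ennreal (\<rho>\<^sup>2) \<ge> ennreal C * E_raw_sq d K N \<sigma> \<epsilon> k \<longrightarrow>
               (\<exists>\<phi>\<in>tests d N. type_I_error d N \<sigma> \<epsilon> \<phi> < ennreal \<alpha> \<and>
                               type_II_error d K N \<sigma> \<epsilon> \<rho> \<phi> < ennreal \<alpha>)) \<and>
            rho_critical d K N \<sigma> \<epsilon> \<alpha> \<le> ennreal C * (MIN k\<in>{1..d}. E_raw d K N \<sigma> \<epsilon> k))))"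
proof (rule exI[of _ "1/4"], intro conjI allI impI)
  fix \<alpha> :: real assume a: "0 < \<alpha> \<and> \<alpha> < 1/2"
  hence \<alpha>: "0 < \<alpha>" "\<alpha> < 1/2" by auto
  define C where "C = sep_const (ln (20 / \<alpha>)) + 4"
  have C: "4 < C" using sep_const_pos[OF \<alpha>] by (simp add: C_def)
  show "\<exists>C::real. 0 < C \<and>
        (\<forall>(d::nat) (K::real Matrix.vec set) (N::nat) (\<sigma>::real) (\<epsilon>::real).
          QCO d K \<and> 1 \<le> N \<and> 0 < \<sigma> \<and> 0 \<le> \<epsilon> \<and> \<epsilon> < 1/4 \<and>
          (SUP \<theta>\<in>K. ennreal (vnorm \<theta>)) > ennreal (\<sigma> / sqrt (real N)) \<longrightarrow>
            (\<forall>k\<in>{1..d}. \<forall>\<rho>::real.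
               0 < \<rho> \<and> ennreal (\<rho>\<^sup>2) \<ge> ennreal C * E_raw_sq d K N \<sigma> \<epsilon> k \<longrightarrow>
               (\<exists>\<phi>\<in>tests d N. type_I_error d N \<sigma> \<epsilon> \<phi> < ennreal \<alpha> \<and>
                               type_II_error d K N \<sigma> \<epsilon> \<rho> \<phi> < ennreal \<alpha>)) \<and>
            rho_critical d K N \<sigma> \<epsilon> \<alpha> \<le> ennreal C * (MIN k\<in>{1..d}. E_raw d K N \<sigma> \<epsilon> k))"
  proof (rule exI[of _ C], rule conjI, use C in simp, intro allI impI)
    fix d :: nat and K :: "real Matrix.vec set" and N :: nat and \<sigma> \<epsilon> :: real
    assume "QCO d K \<and> 1 \<le> N \<and> 0 < \<sigma> \<and> 0 \<le> \<epsilon> \<and> \<epsilon> < 1/4 \<and>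
          (SUP \<theta>\<in>K. ennreal (vnorm \<theta>)) > ennreal (\<sigma> / sqrt (real N))"
    hence K: "QCO d K" and N: "1 \<le> N" and \<sigma>: "0 < \<sigma>" and e: "0 \<le> \<epsilon>" "\<epsilon> < 1/4"
      and big: "ennreal (\<sigma> / sqrt (real N)) < (SUP \<theta>\<in>K. ennreal (vnorm \<theta>))" by auto
    have test: "\<exists>\<phi>\<in>tests d N. type_I_error d N \<sigma> \<epsilon> \<phi> < ennreal \<alpha> \<and> type_II_error d K N \<sigma> \<epsilon> \<rho> \<phi> < ennreal \<alpha>"
      if "k \<in> {1..d}" "0 < \<rho>" "ennreal C * E_raw_sq d K N \<sigma> \<epsilon> k \<le> ennreal (\<rho>\<^sup>2)" for k \<rho>
      using exists_good_test[OF K N \<sigma> that(1) e \<alpha> that(2)] that(3) by (simp add: C_def)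
    \<comment> \<open>In dimension zero all norms vanish, against the assumed size of
      \<open>K\<close>; hence the minimum over \<open>k\<close> is taken over a nonempty
      set.\<close>
    have "d \<noteq> 0"
    proof
      assume "d = 0"
      hence "K \<subseteq> carrier_vec 0" using K by (simp add: QCO_def)
      hence "(SUP \<theta>\<in>K. ennreal (vnorm \<theta>)) \<le> 0"
        by (intro SUP_least) (auto simp: vnorm_def scalar_prod_def)
      thus False using big by simp
    qed
    hence "(MIN k\<in>{1..d}. E_raw d K N \<sigma> \<epsilon> k) \<in> E_raw d K N \<sigma> \<epsilon> ` {1..d}"
      by (intro Min_in) auto
    then obtain k where k: "k \<in> {1..d}" and mink: "(MIN k\<in>{1..d}. E_raw d K N \<sigma> \<epsilon> k) = E_raw d K N \<sigma> \<epsilon> k"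
      by blast
    have "rho_critical d K N \<sigma> \<epsilon> \<alpha> \<le> ennreal C * E_raw d K N \<sigma> \<epsilon> k"
    proof (cases "E_raw_sq d K N \<sigma> \<epsilon> k = \<infinity>")
      case True
      thus ?thesis using C by (simp add: E_raw_def ennsqrt_def ennreal_mult_top)
    next
      case False
      define E where "E = enn2real (E_raw_sq d K N \<sigma> \<epsilon> k)"
      have E: "E_raw_sq d K N \<sigma> \<epsilon> k = ennreal E" using False by (simp add: E_def less_top)
      \<comment> \<open>\<open>rho_critical\<close> ranges over positive radii, so the witness needs
        \<open>E\<close> to be positive.\<close>
      have "0 < sqrt (real k) / real N" using k N by simp
      also have "\<dots> \<le> Max {sqrt (real k) / real N, \<epsilon>\<^sup>2 * ln (1 / \<epsilon>), sqrt (\<epsilon>\<^sup>2 * ln (1 / \<epsilon>) * real k / real N)}"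
        by (rule Max_ge) auto
      finally have "0 < E_raw_sq d K N \<sigma> \<epsilon> k"
        unfolding E_raw_sq_def using \<sigma> by (intro add_nonneg_pos) (simp_all del: Max_insert Max_gr_iff)
      hence E0: "0 < E" by (simp add: E)
      \<comment> \<open>The witness radius has square \<open>C * E\<close>; as
        \<open>sqrt C \<le> C\<close>, the same constant serves the squared and the unsquared
        bound.\<close>
      have "rho_critical d K N \<sigma> \<epsilon> \<alpha> \<le> ennreal (sqrt (C * E))"
        unfolding rho_critical_def
      proof (rule INF_lower, intro CollectI conjI)
        show pos: "0 < sqrt (C * E)" using C E0 by simp
        have "ennreal C * E_raw_sq d K N \<sigma> \<epsilon> k \<le> ennreal ((sqrt (C * E))\<^sup>2)"
          using C E0 by (simp add: E ennreal_mult)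
        from test[OF k pos this] show "\<exists>\<phi>\<in>tests d N. type_I_error d N \<sigma> \<epsilon> \<phi> \<le> ennreal \<alpha> \<and>
            type_II_error d K N \<sigma> \<epsilon> (sqrt (C * E)) \<phi> \<le> ennreal \<alpha>"
          by (meson less_imp_le)
      qed
      also have "\<dots> \<le> ennreal (C * sqrt E)"
      proof -
        have "sqrt C \<le> C" using C by (simp add: real_le_lsqrt self_le_power)
        thus ?thesis using E0 unfolding real_sqrt_mult by (intro ennreal_leI mult_right_mono) auto
      qed
      also have "\<dots> = ennreal C * E_raw d K N \<sigma> \<epsilon> k"
        using C E0 by (simp add: E_raw_def ennsqrt_def E ennreal_mult)
      finally show ?thesis .
    qed
    thus "(\<forall>k\<in>{1..d}. \<forall>\<rho>::real.
               0 < \<rho> \<and> ennreal (\<rho>\<^sup>2) \<ge> ennreal C * E_raw_sq d K N \<sigma> \<epsilon> k \<longrightarrow>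
               (\<exists>\<phi>\<in>tests d N. type_I_error d N \<sigma> \<epsilon> \<phi> < ennreal \<alpha> \<and>
                               type_II_error d K N \<sigma> \<epsilon> \<rho> \<phi> < ennreal \<alpha>)) \<and>
            rho_critical d K N \<sigma> \<epsilon> \<alpha> \<le> ennreal C * (MIN k\<in>{1..d}. E_raw d K N \<sigma> \<epsilon> k)"
      using test mink by simp
  qed
qed auto

end
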